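(* Let $f\in\operatorname{Diff}^1(\mathbb{R}^n)$ be Anosov with respect to a complete Riemannian metric on $\mathbb{R}^n$, with splitting $T\mathbb{R}^n=E^s\oplus E^u$, and let $k=\dim E^s$. Then there exist a complete smooth Riemannian metric $\hat g$ on $\mathbb{R}^n$ and a neighborhood $\mathcal{U}$ of $f$ in the two-sided strong Whitney $C^1$ topology such that every $h\in\mathcal{U}$ is Anosov with respect to $\hat g$, with a splitting $T\mathbb{R}^n=E^s_h\oplus E^u_h$ satisfying $$\dim E^s_h=k,\qquad \dim E^u_h=n-k.$$ The Anosov constants (the numbers $C$ and $\lambda$ in the definition of Anosov for $h$ with respect to $\hat g$) may be chosen independently of $h\in\mathcal{U}$. Consequently, the set of diffeomorphisms in $\operatorname{Diff}^1(\mathbb{R}^n)$ admitting a complete Anosov metric is open in the two-sided strong Whitney $C^1$ topology.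
   Context: A diffeomorphism $f$ of a smooth manifold $M$ is Anosov with respect to a Riemannian metric $\rho$ if there are a continuous $Df$-invariant splitting $TM=E^s\oplus E^u$ (possibly trivial: $E^s=\{0\}$ or $E^u=\{0\}$ allowed) and constants $C\ge 1$, $\lambda\in(0,1)$ (Anosov constants) such that for all integers $m\ge 0$: $\|Df^m(w)\|_\rho\le C\lambda^m\|w\|_\rho$ for $w\in E^s$ and $\|Df^{-m}(w)\|_\rho\le C\lambda^m\|w\|_\rho$ for $w\in E^u$. A diffeomorphism admits a complete Anosov metric if it is Anosov with respect to some complete Riemannian metric. Two-sided strong Whitney $C^1$ topology on $\operatorname{Diff}^1(\mathbb{R}^n)$: a basic neighborhood of $f$ is determined by two continuous functions $\varepsilon_+,\varepsilon_-:\mathbb{R}^n\to(0,\infty)$ and consists of all $h\in\operatorname{Diff}^1(\mathbb{R}^n)$ such that for every $x\in\mathbb{R}^n$, $|h(x)-f(x)|+\|Dh_x-Df_x\|<\varepsilon_+(x)$ and $|h^{-1}(x)-f^{-1}(x)|+\|D(h^{-1})_x-D(f^{-1})_x\|<\varepsilon_-(x)$. *)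

theory Defs
  imports "HOL-Analysis.Analysis"
begin

section \<open>\<open>C\<^sup>k\<close> maps and \<open>C\<^sup>1\<close> diffeomorphisms\<close>

text \<open>In finite dimension, continuity of all directional derivatives \<open>x \<mapsto> Df\<^sub>x v\<close> of a differentiable
  map is continuity of \<open>x \<mapsto> Df\<^sub>x\<close> in the operator norm.\<close>

primrec Ck :: "nat \<Rightarrow> ('a::euclidean_space \<Rightarrow> 'b::euclidean_space) \<Rightarrow> bool" where
  "Ck 0 f \<longleftrightarrow> continuous_on UNIV f"
| "Ck (Suc k) f \<longleftrightarrow> (\<forall>x. f differentiable (at x)) \<and>
      (\<forall>v. Ck k (\<lambda>x. frechet_derivative f (at x) v))"

definition smooth :: "('a::euclidean_space \<Rightarrow> 'b::euclidean_space) \<Rightarrow> bool" where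
  "smooth f \<longleftrightarrow> (\<forall>k. Ck k f)"

definition Diff1 :: "('a::euclidean_space \<Rightarrow> 'a) set" where
  "Diff1 = {f. bij f \<and> Ck 1 f \<and> Ck 1 (inv f)}"


section \<open>Complete Riemannian metrics\<close>

text \<open>The tangent space at every point is identified with the ambient vector space; \<open>g x\<close> is the
  inner product on the tangent space at \<open>x\<close>.\<close>

definition riemannian_metric :: "('a::euclidean_space \<Rightarrow> 'a \<Rightarrow> 'a \<Rightarrow> real) \<Rightarrow> bool" where
  "riemannian_metric g \<longleftrightarrow>
     (\<forall>x. bilinear (g x)) \<and>
     (\<forall>x u v. g x u v = g x v u) \<and>
     (\<forall>x v. v \<noteq> 0 \<longrightarrow> g x v v > 0) \<and>
     (\<forall>u v. smooth (\<lambda>x. g x u v))"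

definition rnorm :: "('a::euclidean_space \<Rightarrow> 'a \<Rightarrow> 'a \<Rightarrow> real) \<Rightarrow> 'a \<Rightarrow> 'a \<Rightarrow> real" where
  "rnorm g x v = sqrt (g x v v)"

text \<open>A \<^const>\<open>valid_path\<close> may have unbounded speed near its finitely many break points. We use
  \<^const>\<open>has_integral\<close> rather than \<^const>\<open>integral\<close>, so that a path of infinite length does not
  count as one of length \<open>0\<close>; admitting paths of finite length with unbounded speed does not change the
  infimum.\<close>

definition riemannian_dist :: "('a::euclidean_space \<Rightarrow> 'a \<Rightarrow> 'a \<Rightarrow> real) \<Rightarrow> 'a \<Rightarrow> 'a \<Rightarrow> real" where
  "riemannian_dist g x y =
     Inf {L. \<exists>\<gamma>. valid_path \<gamma> \<and> pathstart \<gamma> = x \<and> pathfinish \<gamma> = y \<and>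
            ((\<lambda>t. rnorm g (\<gamma> t) (vector_derivative \<gamma> (at t))) has_integral L) {0..1}}"

definition complete_riemannian_metric :: "('a::euclidean_space \<Rightarrow> 'a \<Rightarrow> 'a \<Rightarrow> real) \<Rightarrow> bool" where
  "complete_riemannian_metric g \<longleftrightarrow>
     riemannian_metric g \<and> Metric_space.mcomplete UNIV (riemannian_dist g)"


section \<open>Anosov diffeomorphisms\<close>

text \<open>A continuous subbundle of the tangent bundle: every point has a neighbourhood on which the
  fibres have a continuous frame. Rank \<open>0\<close> is allowed.\<close>

definition continuous_subbundle :: "('a::euclidean_space \<Rightarrow> 'a set) \<Rightarrow> bool" where
  "continuous_subbundle E \<longleftrightarrow>
     (\<forall>p. \<exists>U (r::nat) X. open U \<and> p \<in> U \<and> (\<forall>i<r. continuous_on U (X i)) \<and>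
        (\<forall>x\<in>U. inj_on (\<lambda>i. X i x) {..<r} \<and> independent ((\<lambda>i. X i x) ` {..<r}) \<and>
               E x = span ((\<lambda>i. X i x) ` {..<r})))"

definition continuous_splitting ::
    "('a::euclidean_space \<Rightarrow> 'a set) \<Rightarrow> ('a \<Rightarrow> 'a set) \<Rightarrow> bool" where
  "continuous_splitting Es Eu \<longleftrightarrow>
     continuous_subbundle Es \<and> continuous_subbundle Eu \<and>
     (\<forall>x. Es x \<inter> Eu x = {0} \<and> (\<forall>w. \<exists>u\<in>Es x. \<exists>v\<in>Eu x. w = u + v))"

definition anosov_with ::
    "('a::euclidean_space \<Rightarrow> 'a \<Rightarrow> 'a \<Rightarrow> real) \<Rightarrow> ('a \<Rightarrow> 'a) \<Rightarrow>
     ('a \<Rightarrow> 'a set) \<Rightarrow> ('a \<Rightarrow> 'a set) \<Rightarrow> real \<Rightarrow> real \<Rightarrow> bool" where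
  "anosov_with g f Es Eu C \<mu> \<longleftrightarrow>
     continuous_splitting Es Eu \<and>
     (\<forall>x. frechet_derivative f (at x) ` Es x = Es (f x)) \<and>
     (\<forall>x. frechet_derivative f (at x) ` Eu x = Eu (f x)) \<and>
     C \<ge> 1 \<and> 0 < \<mu> \<and> \<mu> < 1 \<and>
     (\<forall>m x. \<forall>w\<in>Es x.
        rnorm g ((f ^^ m) x) (frechet_derivative (f ^^ m) (at x) w) \<le> C * \<mu> ^ m * rnorm g x w) \<and>
     (\<forall>m x. \<forall>w\<in>Eu x.
        rnorm g ((inv f ^^ m) x) (frechet_derivative (inv f ^^ m) (at x) w) \<le> C * \<mu> ^ m * rnorm g x w)"

definition admits_complete_anosov_metric :: "('a::euclidean_space \<Rightarrow> 'a) \<Rightarrow> bool" where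
  "admits_complete_anosov_metric f \<longleftrightarrow>
     (\<exists>g Es Eu C \<mu>. complete_riemannian_metric g \<and> anosov_with g f Es Eu C \<mu>)"


section \<open>The two-sided strong Whitney \<open>C\<^sup>1\<close> topology\<close>

definition C1_gap :: "('a::euclidean_space \<Rightarrow> 'a) \<Rightarrow> ('a \<Rightarrow> 'a) \<Rightarrow> 'a \<Rightarrow> real" where
  "C1_gap h f x = norm (h x - f x) +
     onorm (\<lambda>v. frechet_derivative h (at x) v - frechet_derivative f (at x) v)"

definition whitney_nbhd ::
    "('a::euclidean_space \<Rightarrow> 'a) \<Rightarrow> ('a \<Rightarrow> real) \<Rightarrow> ('a \<Rightarrow> real) \<Rightarrow> ('a \<Rightarrow> 'a) set" where
  "whitney_nbhd f \<epsilon>p \<epsilon>m =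
     {h \<in> Diff1. \<forall>x. C1_gap h f x < \<epsilon>p x \<and> C1_gap (inv h) (inv f) x < \<epsilon>m x}"

definition whitney_open :: "('a::euclidean_space \<Rightarrow> 'a) set \<Rightarrow> bool" where
  "whitney_open S \<longleftrightarrow> S \<subseteq> Diff1 \<and>
     (\<forall>f\<in>S. \<exists>\<epsilon>p \<epsilon>m. continuous_on UNIV \<epsilon>p \<and> continuous_on UNIV \<epsilon>m \<and>
        (\<forall>x. \<epsilon>p x > 0 \<and> \<epsilon>m x > 0) \<and> whitney_nbhd f \<epsilon>p \<epsilon>m \<subseteq> S)"

definition whitney_topology :: "('a::euclidean_space \<Rightarrow> 'a) topology" where
  "whitney_topology = topology whitney_open"

lemma istopology_whitney_open: "istopology (whitney_open :: ('a::euclidean_space \<Rightarrow> 'a) set \<Rightarrow> bool)"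
  unfolding istopology_def
proof (intro conjI allI impI)
  fix S T :: "('a \<Rightarrow> 'a) set"
  assume S: "whitney_open S" and T: "whitney_open T"
  show "whitney_open (S \<inter> T)"
    unfolding whitney_open_def
  proof (intro conjI ballI)
    show "S \<inter> T \<subseteq> Diff1" using S by (auto simp: whitney_open_def)
    fix f assume f: "f \<in> S \<inter> T"
    obtain a b where ab: "continuous_on UNIV a" "continuous_on UNIV b"
      "\<forall>x. a x > 0 \<and> b x > 0" "whitney_nbhd f a b \<subseteq> S"
      using S f unfolding whitney_open_def by blast
    obtain c d where cd: "continuous_on UNIV c" "continuous_on UNIV d"
      "\<forall>x. c x > 0 \<and> d x > 0" "whitney_nbhd f c d \<subseteq> T"
      using T f unfolding whitney_open_def by blast
    have sub: "whitney_nbhd f (\<lambda>x. min (a x) (c x)) (\<lambda>x. min (b x) (d x)) \<subseteq> S \<inter> T"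
      using ab(4) cd(4) unfolding whitney_nbhd_def by auto
    show "\<exists>\<epsilon>p \<epsilon>m. continuous_on UNIV \<epsilon>p \<and> continuous_on UNIV \<epsilon>m \<and>
        (\<forall>x. \<epsilon>p x > 0 \<and> \<epsilon>m x > 0) \<and> whitney_nbhd f \<epsilon>p \<epsilon>m \<subseteq> S \<inter> T"
      apply (rule exI[of _ "\<lambda>x. min (a x) (c x)"], rule exI[of _ "\<lambda>x. min (b x) (d x)"])
      using ab cd sub by (auto intro: continuous_on_min)
  qed
next
  fix K :: "('a \<Rightarrow> 'a) set set"
  assume K: "\<forall>S\<in>K. whitney_open S"
  show "whitney_open (\<Union>K)"
    unfolding whitney_open_def
  proof (intro conjI ballI)
    show "\<Union>K \<subseteq> Diff1" using K by (auto simp: whitney_open_def)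
    fix f assume "f \<in> \<Union>K"
    then obtain S where S: "S \<in> K" "f \<in> S" by blast
    then obtain a b where "continuous_on UNIV a" "continuous_on UNIV b"
      "\<forall>x. a x > 0 \<and> b x > 0" "whitney_nbhd f a b \<subseteq> S"
      using K unfolding whitney_open_def by blast
    moreover have "S \<subseteq> \<Union>K" using S by blast
    ultimately show "\<exists>\<epsilon>p \<epsilon>m. continuous_on UNIV \<epsilon>p \<and> continuous_on UNIV \<epsilon>m \<and>
        (\<forall>x. \<epsilon>p x > 0 \<and> \<epsilon>m x > 0) \<and> whitney_nbhd f \<epsilon>p \<epsilon>m \<subseteq> \<Union>K"
      by (meson order_trans)
  qed
qed

lemma openin_whitney_topology: "openin whitney_topology S \<longleftrightarrow> whitney_open S"
  by (simp add: whitney_topology_def istopology_whitney_open topology_inverse')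

end

theory Submission
  imports Defs
begin

text \<open>The idea is to characterise hyperbolicity by a Lyapunov form. Adapting the given metric along
  finitely many iterates makes the splitting of \<open>f\<close> orthogonal for a continuous metric \<open>G \<ge> g / 2\<close>
  and yields a continuous quadratic form \<open>J\<close> with \<open>\<bar>J\<bar> \<le> K G\<close> that increases under \<open>Df\<close> by at least
  \<open>c (G\<^sub>x(v) + G\<^sub>f\<^sub>x(Df v))\<close>. Replacing \<open>G\<close> by a comparable smooth metric keeps completeness. The
  increase, tested on unit vectors, is an open condition on \<open>(x, f x, Df\<^sub>x)\<close>, so it persists with a
  smaller \<open>c\<close> for every \<open>h\<close> in a Whitney neighbourhood; only the forward size function is needed.
  For such \<open>h\<close> the vectors whose forward orbit has \<open>J \<le> 0\<close> are exactly those whose forward orbit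
  tends to \<open>0\<close>. They form a closed family of subspaces, the decay rate depends only on \<open>K\<close> and \<open>c\<close>,
  and a compactness argument gives the dimension; the unstable spaces are those of \<open>h\<^sup>-\<^sup>1\<close> and \<open>- J\<close>.\<close>

section \<open>Smooth metrics comparable to continuous ones\<close>

text \<open>On a noncompact space the angle between \<open>Es\<close> and \<open>Eu\<close>,
  measured in the given metric, may tend to \<open>0\<close>, so the projections may be unbounded
  and cone estimates in that metric would have no uniform constants. The adapted metric
  \<open>G\<close> removes this obstacle by construction. It need not be bounded by a multiple of
  the given metric, but completeness passes along the other inequality, from the smaller metric to
  the larger one. \<open>G\<close> is no more regular than the splitting, that is, continuous; this
  alone forces the smoothing. \<open>J\<close> stays merely continuous, since only its values and
  homogeneity enter.

  The increase of \<open>J\<close> is measured by the sizes at both ends of a step. This makes the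
  condition invariant under exchanging \<open>h\<close> with its inverse and \<open>J\<close> with
  \<open>- J\<close>, so every statement about stable spaces is proved once. No persistence theorem
  for the splitting is invoked: the spaces of \<open>h\<close> are defined by the asymptotics of
  orbits, invariance is then immediate, and the only real question is whether they are large enough.
  The old spaces of \<open>f\<close> answer it merely as test spaces on which \<open>J\<close> has a
  sign.\<close>

lemma Ck_SucI:
  assumes "\<And>x. (f has_derivative f' x) (at x)" "\<And>v. Ck k (\<lambda>x. f' x v)"
  shows "Ck (Suc k) f"
proof -
  have "frechet_derivative f (at x) = f' x" for x
    using frechet_derivative_at[OF assms(1)] by simp
  then show ?thesis using assms by (auto simp: differentiable_def)
qed

lemma Ck_Suc_imp_has_derivative:
  "Ck (Suc k) f \<Longrightarrow> (f has_derivative frechet_derivative f (at x)) (at x)"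
  by (simp add: frechet_derivative_works)

lemma Ck_SucD: "Ck (Suc k) f \<Longrightarrow> Ck k f"
proof (induction k arbitrary: f)
  case 0
  then show ?case
    by (auto simp: continuous_on_eq_continuous_at differentiable_imp_continuous_within)
qed (metis Ck.simps(2))

lemma Ck_const: "Ck k (\<lambda>x. c)"
  by (induction k arbitrary: c) auto

lemma Ck_add:
  assumes "Ck k f" "Ck k g"
  shows "Ck k (\<lambda>x. f x + g x)"
  using assms
proof (induction k arbitrary: f g)
  case 0
  then show ?case by (simp add: continuous_on_add)
next
  case (Suc k)
  show ?case
  proof (rule Ck_SucI)
    fix x
    show "((\<lambda>x. f x + g x) has_derivative
        (\<lambda>v. frechet_derivative f (at x) v + frechet_derivative g (at x) v)) (at x)"
      using Suc.prems by (intro has_derivative_add Ck_Suc_imp_has_derivative)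
  qed (use Suc in auto)
qed

lemma Ck_mult:
  fixes f g :: "'a::euclidean_space \<Rightarrow> real"
  assumes "Ck k f" "Ck k g"
  shows "Ck k (\<lambda>x. f x * g x)"
  using assms
proof (induction k arbitrary: f g)
  case 0
  then show ?case by (simp add: continuous_on_mult)
next
  case (Suc k)
  show ?case
  proof (rule Ck_SucI)
    fix x
    show "((\<lambda>x. f x * g x) has_derivative
        (\<lambda>v. f x * frechet_derivative g (at x) v + frechet_derivative f (at x) v * g x)) (at x)"
      using Suc.prems by (intro has_derivative_mult Ck_Suc_imp_has_derivative)
  next
    fix v
    \<comment> \<open>The product rule keeps one factor undifferentiated, so the induction
      hypothesis needs the factors themselves at order \<open>k\<close>.\<close>
    have "Ck k f" "Ck k g" using Suc.prems Ck_SucD by auto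
    then show "Ck k (\<lambda>x. f x * frechet_derivative g (at x) v + frechet_derivative f (at x) v * g x)"
      using Suc by (intro Ck_add Suc.IH) auto
  qed
qed

lemma Ck_linear:
  assumes "linear f"
  shows "Ck k f"
proof (cases k)
  case 0
  then show ?thesis by (simp add: assms linear_continuous_on linear_conv_bounded_linear[symmetric])
next
  case (Suc m)
  show ?thesis unfolding Suc
    by (rule Ck_SucI[where f' = "\<lambda>_. f"])
      (auto intro: bounded_linear_imp_has_derivative Ck_const
        simp: assms linear_conv_bounded_linear[symmetric])
qed

lemma Ck_sum:
  assumes "\<And>i. i \<in> I \<Longrightarrow> Ck k (f i)"
  shows "Ck k (\<lambda>x. \<Sum>i\<in>I. f i x)"
  using assms by (induction I rule: infinite_finite_induct) (auto intro: Ck_const Ck_add)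

text \<open>With a real-valued inner map and a real outer variable the chain rule is a product of
  two scalar functions, so \<open>Ck_mult\<close> closes the induction. This case suffices for a
  bump evaluated at a polynomial.\<close>

lemma Ck_compose:
  fixes \<phi> :: "real \<Rightarrow> real" and q :: "'a::euclidean_space \<Rightarrow> real"
  assumes "Ck k \<phi>" "Ck k q"
  shows "Ck k (\<lambda>x. \<phi> (q x))"
  using assms
proof (induction k arbitrary: \<phi> q)
  case 0
  then show ?case by (auto intro: continuous_on_compose2)
next
  case (Suc k)
  let ?d = "\<lambda>t. frechet_derivative \<phi> (at t) 1"
  show ?case
  proof (rule Ck_SucI)
    fix x
    have \<phi>: "(\<phi> has_derivative frechet_derivative \<phi> (at (q x))) (at (q x))"
      and q: "(q has_derivative frechet_derivative q (at x)) (at x)"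
      using Suc.prems Ck_Suc_imp_has_derivative by blast+
    have "frechet_derivative \<phi> (at (q x)) s = ?d (q x) * s" for s
      using linear_cmul[OF has_derivative_linear[OF \<phi>], of s 1] by simp
    then have eq: "(\<lambda>v. frechet_derivative \<phi> (at (q x)) (frechet_derivative q (at x) v)) =
        (\<lambda>v. ?d (q x) * frechet_derivative q (at x) v)"
      by blast
    show "((\<lambda>x. \<phi> (q x)) has_derivative
        (\<lambda>v. ?d (q x) * frechet_derivative q (at x) v)) (at x)"
      using has_derivative_compose[OF q \<phi>] by (simp only: eq)
  next
    fix v
    have "Ck k ?d" "Ck k (\<lambda>x. frechet_derivative q (at x) v)" using Suc.prems by auto
    then show "Ck k (\<lambda>x. ?d (q x) * frechet_derivative q (at x) v)"
      by (rule Ck_mult[OF Suc.IH[OF _ Ck_SucD[OF Suc.prems(2)]]])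
  qed
qed

text \<open>\<open>Ck\<close> speaks of maps on the whole space, so the local model \<open>F\<close>
  is a global \<open>Ck\<close> map that agrees with \<open>f\<close> near \<open>p\<close>. This is
  the form in which a locally finite sum is differentiated.\<close>

lemma Ck_local:
  assumes "\<And>p. \<exists>U F. open U \<and> p \<in> U \<and> Ck k F \<and> (\<forall>x\<in>U. f x = F x)"
  shows "Ck k f"
  using assms
proof (induction k arbitrary: f)
  case 0
  have "isCont f p" for p
  proof -
    obtain U F where U: "open U" "p \<in> U" "Ck 0 F" "\<forall>x\<in>U. f x = F x" using 0 by blast
    then have "continuous_on U f"
      by (metis Ck.simps(1) continuous_on_cong continuous_on_subset subset_UNIV)
    then show ?thesis using U continuous_on_eq_continuous_at by blast
  qed
  then show ?case by (simp add: continuous_on_eq_continuous_at)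
next
  case (Suc k)
  have *: "\<exists>U F. open U \<and> p \<in> U \<and> Ck (Suc k) F \<and>
      (\<forall>x\<in>U. (f has_derivative frechet_derivative F (at x)) (at x))" for p
  proof -
    obtain U F where U: "open U" "p \<in> U" "Ck (Suc k) F" "\<forall>x\<in>U. f x = F x"
      using Suc.prems by blast
    have "(f has_derivative frechet_derivative F (at x)) (at x)" if "x \<in> U" for x
      using has_derivative_transform_within_open[OF Ck_Suc_imp_has_derivative[OF U(3)] U(1) that] U(4)
      by auto
    then show ?thesis using U by blast
  qed
  show ?case
  proof (rule Ck_SucI)
    fix x
    show "(f has_derivative frechet_derivative f (at x)) (at x)"
      using *[of x] frechet_derivative_at by metis
  next
    fix v
    show "Ck k (\<lambda>x. frechet_derivative f (at x) v)"
    proof (rule Suc.IH)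
      fix p
      obtain U F where U: "open U" "p \<in> U" "Ck (Suc k) F"
        "\<forall>x\<in>U. (f has_derivative frechet_derivative F (at x)) (at x)"
        using * by blast
      then have "\<forall>x\<in>U. frechet_derivative f (at x) v = frechet_derivative F (at x) v"
        using frechet_derivative_at by metis
      then show "\<exists>U F. open U \<and> p \<in> U \<and> Ck k F \<and> (\<forall>x\<in>U. frechet_derivative f (at x) v = F x)"
        using U by (intro exI[of _ U] exI[of _ "\<lambda>x. frechet_derivative F (at x) v"]) auto
    qed
  qed
qed

lemma Ck_real_polynomial_function:
  assumes "real_polynomial_function p"
  shows "Ck k p"
  using assms
  by (induction rule: real_polynomial_function.induct)
    (auto intro: Ck_linear Ck_const Ck_add Ck_mult bounded_linear.linear)

text \<open>The classical \<open>exp (- 1/t)\<close>, extended by \<open>0\<close>, is the case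
  \<open>n = 0\<close>. The powers of \<open>1/t\<close> are included because derivatives of
  \<open>flat n\<close> are linear combinations of members of the same family, which permits an
  induction for all \<open>n\<close> at once.\<close>

definition flat :: "nat \<Rightarrow> real \<Rightarrow> real" where
  "flat n t = (if t > 0 then inverse t ^ n * exp (- inverse t) else 0)"

text \<open>This is the difference quotient of \<open>flat n\<close> at \<open>0\<close>. From the
  right, the substitution \<open>s = 1/t\<close> turns it into \<open>s ^ (n + 1) / exp s\<close> as
  \<open>s\<close> tends to infinity.\<close>

lemma flat_over_t_tendsto_0: "((\<lambda>t. flat n t / t) \<longlongrightarrow> 0) (at 0)"
proof -
  have "((\<lambda>t::real. inverse t ^ Suc n / exp (inverse t)) \<longlongrightarrow> 0) (at_right 0)"
    using filterlim_compose[OF tendsto_power_div_exp_0 filterlim_inverse_at_top_right] .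
  moreover have "\<forall>\<^sub>F t in at_right 0. inverse t ^ Suc n / exp (inverse t) = flat n t / t"
    by (simp add: eventually_at_filter flat_def exp_minus field_simps)
  ultimately have "((\<lambda>t. flat n t / t) \<longlongrightarrow> 0) (at_right 0)"
    by (rule Lim_transform_eventually)
  moreover have "((\<lambda>t. flat n t / t) \<longlongrightarrow> 0) (at_left 0)"
    by (rule Lim_transform_eventually[OF tendsto_const])
      (simp add: eventually_at_filter flat_def)
  ultimately show ?thesis by (simp add: filterlim_split_at)
qed

lemma flat_has_derivative:
  "(flat n has_real_derivative (- real n * flat (Suc n) t + flat (n + 2) t)) (at t)"
proof -
  consider "t > 0" | "t < 0" | "t = 0" by linarith
  then show ?thesis
  proof cases
    case 1
    have "((\<lambda>t. inverse t ^ n * exp (- inverse t)) has_real_derivative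
        (- real n * flat (Suc n) t + flat (n + 2) t)) (at t)"
    proof -
      have "((\<lambda>t. inverse t ^ n * exp (- inverse t)) has_real_derivative
          (inverse t ^ n * (exp (- inverse t) * (inverse t * inverse t))
            + (real n * inverse t ^ (n - Suc 0) * - (inverse t * inverse t)) * exp (- inverse t))) (at t)"
        using 1 by (auto intro!: derivative_eq_intros)
      \<comment> \<open>The subtraction truncates at \<open>n = 0\<close>, where the factor
        \<open>real n\<close> makes the term vanish anyway.\<close>
      moreover have "real n * inverse t ^ (n - Suc 0) * - (inverse t * inverse t) = - (real n * inverse t ^ Suc n)"
        by (cases n) simp_all
      ultimately have "((\<lambda>t. inverse t ^ n * exp (- inverse t)) has_real_derivative
          (inverse t ^ n * (exp (- inverse t) * (inverse t * inverse t))
            + - (real n * inverse t ^ Suc n) * exp (- inverse t))) (at t)"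
        by metis
      then show ?thesis using 1 by (simp add: flat_def mult_ac add.commute)
    qed
    then show ?thesis
      by (rule has_field_derivative_transform_within_open[where S = "{0<..}"])
        (use 1 in \<open>auto simp: flat_def\<close>)
  next
    case 2
    have "((\<lambda>t. 0) has_real_derivative (- real n * flat (Suc n) t + flat (n + 2) t)) (at t)"
      using 2 by (simp add: flat_def)
    then show ?thesis
      by (rule has_field_derivative_transform_within_open[where S = "{..<0}"])
        (use 2 in \<open>auto simp: flat_def\<close>)
  next
    case 3
    then show ?thesis
      using flat_over_t_tendsto_0[of n] by (simp add: has_field_derivative_iff flat_def)
  qed
qed

lemma Ck_flat: "Ck k (flat n)"
proof (induction k arbitrary: n)
  case 0
  then show ?case
    by (auto simp: continuous_on_eq_continuous_at intro: DERIV_isCont[OF flat_has_derivative])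
next
  case (Suc k)
  show ?case
  proof (rule Ck_SucI)
    show "(flat n has_derivative (\<lambda>v. (- real n * flat (Suc n) t + flat (n + 2) t) * v)) (at t)" for t
      using flat_has_derivative by (simp add: has_field_derivative_def)
    show "Ck k (\<lambda>t. (- real n * flat (Suc n) t + flat (n + 2) t) * v)" for v
      by (intro Ck_mult Ck_add Ck_const Suc.IH)
  qed
qed

text \<open>Positive exactly on the open interval from \<open>-1\<close> to \<open>2\<close>. The
  unit interval, where a positive lower bound holds, lies well inside, so the integer translates
  overlap boundedly and one of them is bounded below at each point \<open>t >= 0\<close>.\<close>

definition bump :: "real \<Rightarrow> real" where
  "bump t = flat 0 (t + 1) * flat 0 (2 - t)"

lemma Ck_bump: "Ck k bump"
proof -
  have "Ck k (\<lambda>t::real. t)" by (intro Ck_linear linearI) auto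
  then have affine: "Ck k (\<lambda>t::real. t + 1)" "Ck k (\<lambda>t::real. 2 + (-1) * t)"
    by (intro Ck_add Ck_const Ck_mult; assumption)+
  have "Ck k (\<lambda>t. flat 0 (t + 1) * flat 0 (2 + (-1) * t))"
    by (intro Ck_mult Ck_compose[OF Ck_flat] affine)
  then show ?thesis by (simp add: bump_def[abs_def])
qed

lemma bump_nonneg: "bump t \<ge> 0"
  and bump_le_1: "bump t \<le> 1"
  and bump_eq_0: "t \<le> -1 \<or> t \<ge> 2 \<Longrightarrow> bump t = 0"
  and bump_ge: "0 \<le> t \<Longrightarrow> t \<le> 1 \<Longrightarrow> bump t \<ge> exp (-2)"
proof -
  show "bump t \<ge> 0" "t \<le> -1 \<or> t \<ge> 2 \<Longrightarrow> bump t = 0"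
    by (auto simp: bump_def flat_def)
  have "0 \<le> flat 0 s" "flat 0 s \<le> 1" for s by (auto simp: flat_def)
  then show "bump t \<le> 1" by (simp add: bump_def mult_le_one)
  assume t: "0 \<le> t" "t \<le> 1"
  \<comment> \<open>For \<open>t\<close> in the unit interval both arguments \<open>t + 1\<close>
    and \<open>2 - t\<close> are at least \<open>1\<close>.\<close>
  have "exp (-1) \<le> flat 0 s" if "s \<ge> 1" for s
    using that by (simp add: flat_def inverse_le_1_iff)
  then have "exp (-1) * exp (-1) \<le> bump t"
    unfolding bump_def using t by (intro mult_mono) (auto simp: flat_def)
  then show "bump t \<ge> exp (-2)" by (simp add: exp_add[symmetric])
qed

text \<open>A Riemannian metric with smoothness weakened to continuity. A metric adapted to an
  Anosov splitting inherits only the regularity of the splitting.\<close>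

definition continuous_metric :: "('a::euclidean_space \<Rightarrow> 'a \<Rightarrow> 'a \<Rightarrow> real) \<Rightarrow> bool" where
  "continuous_metric g \<longleftrightarrow>
     (\<forall>x. bilinear (g x)) \<and> (\<forall>x u v. g x u v = g x v u) \<and>
     (\<forall>x v. v \<noteq> 0 \<longrightarrow> g x v v > 0) \<and> (\<forall>u v. continuous_on UNIV (\<lambda>x. g x u v))"

section \<open>Estimates for continuous metrics on compact sets\<close>

lemma riemannian_imp_continuous_metric: "riemannian_metric g \<Longrightarrow> continuous_metric g"
  unfolding riemannian_metric_def continuous_metric_def smooth_def by (metis Ck.simps(1))

lemma continuous_metric_nonneg:
  assumes "continuous_metric g"
  shows "g x v v \<ge> 0"
  using assms bilinear_lzero[of "g x" v]
  by (cases "v = 0") (auto simp: continuous_metric_def intro: less_imp_le)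

lemma bilinear_scaleR_diag: "bilinear h \<Longrightarrow> h (c *\<^sub>R v) (c *\<^sub>R v) = c\<^sup>2 * (h v v :: real)"
  by (simp add: bilinear_lmul bilinear_rmul power2_eq_square)

lemma bilinear_basis_expansion:
  fixes h :: "'a::euclidean_space \<Rightarrow> 'a \<Rightarrow> real"
  assumes "bilinear h"
  shows "h u v = (\<Sum>i\<in>Basis. \<Sum>j\<in>Basis. (u \<bullet> i) * (v \<bullet> j) * h i j)"
proof -
  have "h u v = h (\<Sum>i\<in>Basis. (u \<bullet> i) *\<^sub>R i) (\<Sum>j\<in>Basis. (v \<bullet> j) *\<^sub>R j)"
    by (simp add: euclidean_representation)
  also have "\<dots> = (\<Sum>(i, j)\<in>Basis \<times> Basis. h ((u \<bullet> i) *\<^sub>R i) ((v \<bullet> j) *\<^sub>R j))"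
    by (rule bilinear_sum[OF assms])
  finally show ?thesis
    using assms by (simp add: sum.cartesian_product bilinear_lmul bilinear_rmul mult.assoc)
qed

text \<open>The definition gives continuity in the base point for fixed vectors only. Expanding in a
  basis reduces joint continuity to finitely many such coefficients.\<close>

lemma continuous_on_metric:
  assumes "continuous_metric g" "continuous_on S a" "continuous_on S b" "continuous_on S c"
  shows "continuous_on S (\<lambda>s. g (a s) (b s) (c s))"
proof -
  have bil: "bilinear (g x)" and cont: "continuous_on UNIV (\<lambda>x. g x u v)" for x u v
    using assms(1) by (auto simp: continuous_metric_def)
  have "continuous_on S (\<lambda>s. \<Sum>i\<in>Basis. \<Sum>j\<in>Basis. (b s \<bullet> i) * (c s \<bullet> j) * g (a s) i j)"
    by (intro continuous_intros assms(2-) continuous_on_compose2[OF cont assms(2)]) auto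
  then show ?thesis by (subst bilinear_basis_expansion[OF bil])
qed

text \<open>The minimum over \<open>B\<close> times the unit sphere is attained and positive;
  quadratic homogeneity carries it to all vectors.\<close>

lemma continuous_metric_compact_lower:
  assumes "continuous_metric g" "compact B"
  obtains m where "m > 0" "\<And>x v. x \<in> B \<Longrightarrow> m * (norm v)\<^sup>2 \<le> g x v v"
proof -
  have bil: "bilinear (g x)" for x using assms(1) by (auto simp: continuous_metric_def)
  have "\<exists>m>0. \<forall>z\<in>B \<times> sphere 0 1. m \<le> g (fst z) (snd z) (snd z)"
  proof (cases "B = {}")
    case False
    have comp: "compact (B \<times> sphere (0::'a) 1)" using assms(2) by (simp add: compact_Times)
    have ne: "B \<times> sphere (0::'a) 1 \<noteq> {}"
      using False by simp
    have "continuous_on (B \<times> sphere 0 1) (\<lambda>z. g (fst z) (snd z) (snd z))"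
      by (intro continuous_on_metric[OF assms(1)] continuous_intros)
    from continuous_attains_inf[OF comp ne this]
    obtain z where z: "z \<in> B \<times> sphere 0 1"
        "\<forall>w\<in>B \<times> sphere 0 1. g (fst z) (snd z) (snd z) \<le> g (fst w) (snd w) (snd w)"
      by blast
    have "g (fst z) (snd z) (snd z) > 0"
    proof -
      have "snd z \<noteq> 0" using z(1) by auto
      then show ?thesis using assms(1) by (simp add: continuous_metric_def)
    qed
    then show ?thesis using z(2) by blast
  qed (auto intro: exI[of _ 1])
  then obtain m where "m > 0" and le: "\<forall>z\<in>B \<times> sphere 0 1. m \<le> g (fst z) (snd z) (snd z)" by blast
  then have m: "m > 0" "\<And>x v. x \<in> B \<Longrightarrow> norm v = 1 \<Longrightarrow> m \<le> g x v v" by simp_all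
  have "m * (norm v)\<^sup>2 \<le> g x v v" if "x \<in> B" for x v
  proof (cases "v = 0")
    case True
    then show ?thesis using bilinear_lzero[OF bil] by simp
  next
    case False
    have "m \<le> g x ((1 / norm v) *\<^sub>R v) ((1 / norm v) *\<^sub>R v)"
      using m(2)[OF that, of "(1 / norm v) *\<^sub>R v"] False by simp
    then show ?thesis
      using False unfolding bilinear_scaleR_diag[OF bil] by (simp add: field_simps)
  qed
  then show ?thesis using m(1) that by blast
qed

lemma continuous_metric_compact_upper:
  assumes "continuous_metric g" "compact B"
  obtains m where "m > 0" "\<And>x v. x \<in> B \<Longrightarrow> g x v v \<le> m * (norm v)\<^sup>2"
proof -
  have bil: "bilinear (g x)" for x using assms(1) by (auto simp: continuous_metric_def)
  have "compact (B \<times> sphere (0::'a) 1)" using assms(2) by (simp add: compact_Times)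
  then have "bounded ((\<lambda>z. g (fst z) (snd z) (snd z)) ` (B \<times> sphere 0 1))"
    by (intro compact_imp_bounded compact_continuous_image continuous_on_metric[OF assms(1)]
        continuous_intros)
  then obtain m where m: "m > 0" "\<forall>r\<in>(\<lambda>z. g (fst z) (snd z) (snd z)) ` (B \<times> sphere 0 1). norm r \<le> m"
    using bounded_pos by metis
  have m2: "g x v v \<le> m" if "x \<in> B" "norm v = 1" for x v
    using m(2) that by (force simp: image_iff)
  have "g x v v \<le> m * (norm v)\<^sup>2" if "x \<in> B" for x v
  proof (cases "v = 0")
    case True
    then show ?thesis using bilinear_lzero[OF bil] by simp
  next
    case False
    have "g x ((1 / norm v) *\<^sub>R v) ((1 / norm v) *\<^sub>R v) \<le> m"
      using m2[OF that, of "(1 / norm v) *\<^sub>R v"] False by simp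
    then show ?thesis
      using False unfolding bilinear_scaleR_diag[OF bil] by (simp add: field_simps)
  qed
  then show ?thesis using m(1) that by blast
qed

text \<open>Stone-Weierstrass is applied to the finitely many coefficients of \<open>G\<close>. On
  \<open>B\<close> the total error is at most half of the smallest value of \<open>G\<close> on unit
  vectors. Off \<open>B\<close> the form \<open>P\<close> need not be positive.\<close>

lemma polynomial_metric_approximation:
  fixes G :: "'a::euclidean_space \<Rightarrow> 'a \<Rightarrow> 'a \<Rightarrow> real"
  assumes G: "continuous_metric G" and "compact B"
  obtains P where "\<And>x. bilinear (P x)" "\<And>x u v. P x u v = P x v u"
    "\<And>k u v. Ck k (\<lambda>x. P x u v)"
    "\<And>x v. x \<in> B \<Longrightarrow> G x v v / 2 \<le> P x v v" "\<And>x v. x \<in> B \<Longrightarrow> P x v v \<le> 2 * G x v v"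
proof -
  have bil: "bilinear (G x)" and sym: "G x u v = G x v u"
    and cont: "continuous_on UNIV (\<lambda>x. G x u v)" for x u v
    using G by (auto simp: continuous_metric_def)
  obtain m where m: "m > 0" "\<And>x v. x \<in> B \<Longrightarrow> m * (norm v)\<^sup>2 \<le> G x v v"
    using continuous_metric_compact_lower[OF assms] by blast
  \<comment> \<open>There are \<open>DIM('a)\<close> squared coefficients, each contributing at most
    \<open>e\<close> times the square of \<open>norm v\<close>, so the errors add up to
    \<open>m / 2\<close>.\<close>
  define e where "e = m / (2 * (real DIM('a))\<^sup>2)"
  have "e > 0" using m(1) by (simp add: e_def)
  have "\<exists>p. real_polynomial_function p \<and> (\<forall>x\<in>B. \<bar>G x u v - p x\<bar> < e)" for u v
    using Stone_Weierstrass_real_polynomial_function[OF \<open>compact B\<close>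
        continuous_on_subset[OF cont subset_UNIV] \<open>e > 0\<close>, of u v]
    by (metis)
  then obtain p where p: "\<And>u v. real_polynomial_function (p u v)"
      "\<And>u v x. x \<in> B \<Longrightarrow> \<bar>G x u v - p u v x\<bar> < e"
    by metis
  \<comment> \<open>The polynomials for \<open>(i, j)\<close> and \<open>(j, i)\<close> are chosen
    independently; averaging restores symmetry without increasing the error.\<close>
  define Q where "Q = (\<lambda>i j x. (p i j x + p j i x) / 2)"
  define P where "P = (\<lambda>x u v. \<Sum>i\<in>Basis. \<Sum>j\<in>Basis. (u \<bullet> i) * (v \<bullet> j) * Q i j x)"
  have Q: "\<bar>Q i j x - G x i j\<bar> \<le> e" if "x \<in> B" for i j x
  proof -
    have "\<bar>G x i j - p i j x\<bar> < e" "\<bar>G x i j - p j i x\<bar> < e"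
      using p(2)[OF that, of i j] p(2)[OF that, of j i] sym[of x j i] by simp_all
    then show ?thesis unfolding Q_def by (simp add: abs_le_iff abs_less_iff field_simps)
  qed
  have CkQ: "Ck k (Q i j)" for k i j
  proof -
    have "Ck k (\<lambda>x. (p i j x + p j i x) * (1/2))"
      by (intro Ck_mult Ck_add Ck_const Ck_real_polynomial_function p)
    then show ?thesis by (simp add: Q_def)
  qed
  have err: "\<bar>P x v v - G x v v\<bar> \<le> m / 2 * (norm v)\<^sup>2" if "x \<in> B" for x v
  proof -
    have "\<bar>P x v v - G x v v\<bar> = \<bar>\<Sum>i\<in>Basis. \<Sum>j\<in>Basis. (v \<bullet> i) * (v \<bullet> j) * (Q i j x - G x i j)\<bar>"
      unfolding P_def bilinear_basis_expansion[OF bil, of x v v]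
      by (simp add: sum_subtractf right_diff_distrib)
    also have "\<dots> \<le> (\<Sum>i\<in>Basis. \<Sum>j\<in>Basis. \<bar>(v \<bullet> i) * (v \<bullet> j) * (Q i j x - G x i j)\<bar>)"
      by (rule order_trans[OF sum_abs sum_mono[OF sum_abs]])
    also have "\<dots> \<le> (\<Sum>i\<in>(Basis::'a set). \<Sum>j\<in>(Basis::'a set). norm v * norm v * e)"
      unfolding abs_mult
      by (intro sum_mono mult_mono Basis_le_norm Q that) auto
    also have "\<dots> = m / 2 * (norm v)\<^sup>2"
      by (simp add: e_def power2_eq_square)
    finally show ?thesis .
  qed
  show ?thesis
  proof
    show "bilinear (P x)" for x
      unfolding bilinear_def P_def
      by (intro conjI allI linear_compose_sum ballI; rule linearI; simp add: inner_left_distrib algebra_simps)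
    have "P x u v = (\<Sum>j\<in>Basis. \<Sum>i\<in>Basis. (u \<bullet> i) * (v \<bullet> j) * Q i j x)" for x u v
      unfolding P_def by (rule sum.swap)
    then show "P x u v = P x v u" for x u v
      by (simp add: P_def Q_def mult.commute add.commute)
    show "Ck k (\<lambda>x. P x u v)" for k u v
      unfolding P_def by (intro Ck_sum Ck_mult Ck_const CkQ)
    show "G x v v / 2 \<le> P x v v" "P x v v \<le> 2 * G x v v" if "x \<in> B" for x v
      using abs_le_D1[OF err[OF that, of v]] abs_le_D2[OF err[OF that, of v]]
        m(2)[OF that, of v] continuous_metric_nonneg[OF G, of x v]
      by simp_all
  qed
qed

text \<open>A locally finite combination, weighted by bumps on the shells \<open>k - 1 < |x|\<^sup>2 < k + 2\<close>, of
  polynomial approximations of the metric. Bounded overlap suffices, so the bumps need not be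
  normalised to a partition of unity.\<close>

lemma smooth_comparable_metric:
  fixes G :: "'a::euclidean_space \<Rightarrow> 'a \<Rightarrow> 'a \<Rightarrow> real"
  assumes G: "continuous_metric G"
  obtains g K where "riemannian_metric g" "K > 0" "\<And>x v. g x v v \<le> K * G x v v"
    "\<And>x v. G x v v \<le> K * g x v v"
proof -
  \<comment> \<open>The weight \<open>w k\<close> below vanishes once
    \<open>x \<bullet> x >= k + 2\<close>, so each approximation is used only on the ball where it
    is good.\<close>
  let ?B = "\<lambda>k::nat. cball (0::'a) (sqrt (k + 2))"
  have "\<forall>k. \<exists>P. (\<forall>x. bilinear (P x)) \<and> (\<forall>x u v. P x u v = P x v u) \<and> (\<forall>m u v. Ck m (\<lambda>x. P x u v)) \<and>
      (\<forall>x\<in>?B k. \<forall>v. G x v v / 2 \<le> P x v v \<and> P x v v \<le> 2 * G x v v)"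
    by (intro allI, rule polynomial_metric_approximation[OF G compact_cball]) blast
  from choice[OF this] obtain P where "\<forall>k. (\<forall>x. bilinear (P k x)) \<and>
      (\<forall>x u v. P k x u v = P k x v u) \<and> (\<forall>m u v. Ck m (\<lambda>x. P k x u v)) \<and>
      (\<forall>x\<in>?B k. \<forall>v. G x v v / 2 \<le> P k x v v \<and> P k x v v \<le> 2 * G x v v)" ..
  then have P: "\<And>k x. bilinear (P k x)" "\<And>k x u v. P k x u v = P k x v u"
      "\<And>k m u v. Ck m (\<lambda>x. P k x u v)"
      "\<And>k x v. x \<in> ?B k \<Longrightarrow> G x v v / 2 \<le> P k x v v \<and> P k x v v \<le> 2 * G x v v"
    by blast+
  define w where "w = (\<lambda>(k::nat) (x::'a). bump (x \<bullet> x - k))"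
  \<comment> \<open>Beyond this index \<open>x \<bullet> x - k\<close> is below \<open>-1\<close>,
    so all further weights vanish at \<open>x\<close>.\<close>
  define N where "N = (\<lambda>r::real. nat \<lceil>r + 1\<rceil>)"
  define g where "g = (\<lambda>x u v. \<Sum>k\<le>N (x \<bullet> x). w k x * P k x u v)"
  have w0: "w k x = 0" if "N (x \<bullet> x) < k" for k x
    unfolding w_def by (rule bump_eq_0) (use that in \<open>simp add: N_def; linarith\<close>)
  have g_eq: "g x u v = (\<Sum>k\<le>n. w k x * P k x u v)" if "N (x \<bullet> x) \<le> n" for x u v n
    unfolding g_def by (rule sum.mono_neutral_left) (use that w0 in auto)
  have Ckw: "Ck m (w k)" for m k
  proof -
    have "Ck m (\<lambda>x::'a. (\<Sum>i\<in>Basis. (x \<bullet> i) * (x \<bullet> i)) + (- real k))"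
      by (intro Ck_add Ck_const Ck_sum Ck_mult Ck_linear)
        (auto intro!: linearI simp: inner_left_distrib)
    then have "Ck m (\<lambda>x::'a. x \<bullet> x - real k)" by (simp add: euclidean_inner[symmetric])
    from Ck_compose[OF Ck_bump this] show ?thesis by (simp add: w_def)
  qed
  have wP: "w k x * (G x v v / 2) \<le> w k x * P k x v v" "w k x * P k x v v \<le> w k x * (2 * G x v v)"
    for k x v
  proof -
    have "w k x = 0 \<or> x \<in> ?B k"
    proof (rule disjCI)
      assume "x \<notin> ?B k"
      then have "x \<bullet> x - k \<ge> 2"
        by (simp add: norm_eq_sqrt_inner)
      then show "w k x = 0" unfolding w_def by (intro bump_eq_0) auto
    qed
    then consider "w k x = 0" | "G x v v / 2 \<le> P k x v v" "P k x v v \<le> 2 * G x v v"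
      using P(4) by blast
    then show "w k x * (G x v v / 2) \<le> w k x * P k x v v"
      "w k x * P k x v v \<le> w k x * (2 * G x v v)"
      by (cases; simp only: mult_zero_left order_refl w_def mult_left_mono bump_nonneg)+
  qed
  have shell: "\<exists>m::nat. real m \<le> x \<bullet> x \<and> x \<bullet> x < real m + 1" for x :: 'a
    using floor_correct[of "x \<bullet> x"] by (intro exI[of _ "nat \<lfloor>x \<bullet> x\<rfloor>"]) simp
  have Gnn: "G x v v \<ge> 0" for x v by (rule continuous_metric_nonneg[OF G])
  \<comment> \<open>At most the indices \<open>m - 1\<close>, \<open>m\<close>, \<open>m + 1\<close>
    contribute, each with weight at most \<open>1\<close> and form at most \<open>2 * G\<close>,
    hence the factor \<open>6\<close>. For \<open>m = 0\<close> the truncated \<open>m - 1\<close>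
    only makes the index set smaller.\<close>
  have upper: "g x v v \<le> 6 * G x v v" for x v
  proof -
    obtain m :: nat where m: "real m \<le> x \<bullet> x" "x \<bullet> x < real m + 1"
      using shell by blast
    have w0': "w k x = 0" if "k \<notin> {m - 1..m + 1}" for k
      unfolding w_def by (rule bump_eq_0) (use that m in auto)
    let ?n = "N (x \<bullet> x) + (m + 1)"
    have "g x v v = (\<Sum>k\<le>?n. w k x * P k x v v)" by (rule g_eq) simp
    also have "\<dots> = (\<Sum>k\<in>{m - 1..m + 1}. w k x * P k x v v)"
      by (rule sum.mono_neutral_right) (use w0' in auto)
    also have "\<dots> \<le> (\<Sum>k\<in>{m - 1..m + 1}. 2 * G x v v)"
    proof (rule sum_mono)
      fix k
      have "w k x * (2 * G x v v) \<le> 1 * (2 * G x v v)"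
        unfolding w_def using Gnn by (intro mult_right_mono bump_le_1) auto
      then show "w k x * P k x v v \<le> 2 * G x v v" using wP(2)[of k x v] by linarith
    qed
    also have "\<dots> = real (card {m - 1..m + 1}) * (2 * G x v v)" by simp
    also have "\<dots> \<le> 3 * (2 * G x v v)"
      using Gnn by (intro mult_right_mono) auto
    finally show ?thesis by simp
  qed
  \<comment> \<open>The weight of the shell that contains \<open>x\<close> is at least
    \<open>exp (-2)\<close> and its form is at least \<open>G / 2\<close>; the other terms are
    nonnegative.\<close>
  have lower: "G x v v \<le> 2 * exp 2 * g x v v" for x v
  proof -
    obtain m :: nat where m: "real m \<le> x \<bullet> x" "x \<bullet> x < real m + 1"
      using shell by blast
    have "exp (-2) * (G x v v / 2) \<le> w m x * (G x v v / 2)"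
      unfolding w_def using Gnn m by (intro mult_right_mono bump_ge) auto
    also have "\<dots> \<le> w m x * P m x v v" by (rule wP)
    also have "\<dots> \<le> g x v v"
      unfolding g_def
    proof (rule member_le_sum)
      show "m \<in> {..N (x \<bullet> x)}" using m by (simp add: N_def; linarith)
      show "0 \<le> w k x * P k x v v" for k
        using wP(1)[of k x v] Gnn[of x v] bump_nonneg
        by (metis w_def order_trans mult_nonneg_nonneg divide_nonneg_pos zero_less_numeral)
    qed simp
    finally have "exp 2 * (exp (-2) * (G x v v / 2)) \<le> exp 2 * g x v v" by simp
    then show ?thesis by (simp add: mult.assoc[symmetric] exp_add[symmetric])
  qed
  have g: "riemannian_metric g"
    unfolding riemannian_metric_def
  proof (intro conjI allI impI)
    show "bilinear (g x)" for x
    proof -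
      have "linear (\<lambda>v. w k x * P k x u v)" "linear (\<lambda>u. w k x * P k x u v)" for k u v
        using P(1)[of k x] linear_compose_scale_right[of "P k x u" "w k x"]
          linear_compose_scale_right[of "\<lambda>u. P k x u v" "w k x"] by (simp_all add: bilinear_def)
      then show ?thesis unfolding bilinear_def g_def by (intro conjI allI linear_compose_sum ballI)
    qed
    show "g x u v = g x v u" for x u v
      unfolding g_def by (intro sum.cong refl arg_cong2[where f = "(*)"] P(2))
    show "g x v v > 0" if "v \<noteq> 0" for x v
    proof -
      have "0 < G x v v" using G that by (auto simp: continuous_metric_def)
      also have "\<dots> \<le> 2 * exp 2 * g x v v" by (rule lower)
      finally show ?thesis by (simp add: zero_less_mult_iff)
    qed
    show "smooth (\<lambda>x. g x u v)" for u v
      unfolding smooth_def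
    proof (intro allI Ck_local)
      \<comment> \<open>The upper summation index in \<open>g\<close> varies with \<open>x\<close>.
        On a neighbourhood of \<open>p\<close> one fixed index serves all points, because the added
        terms vanish.\<close>
      fix m and p :: 'a
      let ?r = "p \<bullet> p + 1"
      have "open {x::'a. x \<bullet> x < ?r}"
        by (intro open_Collect_less continuous_intros)
      moreover have "g x u v = (\<Sum>k\<le>N ?r. w k x * P k x u v)" if "x \<bullet> x < ?r" for x
      proof (rule g_eq)
        show "N (x \<bullet> x) \<le> N ?r" unfolding N_def using that by (intro nat_mono ceiling_mono) simp
      qed
      moreover have "Ck m (\<lambda>x. \<Sum>k\<le>N ?r. w k x * P k x u v)"
        by (intro Ck_sum Ck_mult Ckw P(3))
      ultimately show "\<exists>U F. open U \<and> p \<in> U \<and> Ck m F \<and> (\<forall>x\<in>U. g x u v = F x)"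
        by (intro exI[of _ "{x. x \<bullet> x < ?r}"] exI[of _ "\<lambda>x. \<Sum>k\<le>N ?r. w k x * P k x u v"]
            conjI ballI; simp only: mem_Collect_eq less_add_one)
    qed
  qed
  \<comment> \<open>The constants \<open>6\<close> and \<open>2 * exp 2\<close> are merged into the
    larger one.\<close>
  have "exp (2::real) \<ge> 3" using exp_ge_add_one_self[of 2] by simp
  then have "g x v v \<le> 2 * exp 2 * G x v v" for x v
    using upper[of x v] mult_right_mono[of 3 "exp 2" "G x v v"] Gnn[of x v] by linarith
  then show ?thesis using that[OF g, of "2 * exp 2"] lower by simp
qed


section \<open>Comparison of Riemannian distances\<close>

lemma rnorm_nonneg: "continuous_metric g \<Longrightarrow> rnorm g x v \<ge> 0"
  by (simp add: rnorm_def continuous_metric_nonneg)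

lemma rnorm_scaleR: "continuous_metric g \<Longrightarrow> rnorm g x (c *\<^sub>R v) = \<bar>c\<bar> * rnorm g x v"
  by (simp add: rnorm_def continuous_metric_def bilinear_scaleR_diag real_sqrt_mult)

lemma rnorm_minus: "continuous_metric g \<Longrightarrow> rnorm g x (- v) = rnorm g x v"
  using rnorm_scaleR[of g x "-1" v] by simp

lemma continuous_on_rnorm:
  assumes "continuous_metric g" "continuous_on S a" "continuous_on S b"
  shows "continuous_on S (\<lambda>s. rnorm g (a s) (b s))"
  unfolding rnorm_def by (rule continuous_on_real_sqrt[OF continuous_on_metric[OF assms(1,2,3,3)]])

definition path_lengths :: "('a::euclidean_space \<Rightarrow> 'a \<Rightarrow> 'a \<Rightarrow> real) \<Rightarrow> 'a \<Rightarrow> 'a \<Rightarrow> real set" where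
  "path_lengths g x y = {L. \<exists>\<gamma>. valid_path \<gamma> \<and> pathstart \<gamma> = x \<and> pathfinish \<gamma> = y \<and>
     ((\<lambda>t. rnorm g (\<gamma> t) (vector_derivative \<gamma> (at t))) has_integral L) {0..1}}"

lemma riemannian_dist_eq: "riemannian_dist g x y = Inf (path_lengths g x y)"
  by (simp add: riemannian_dist_def path_lengths_def)

lemma path_lengths_nonneg: "continuous_metric g \<Longrightarrow> L \<in> path_lengths g x y \<Longrightarrow> L \<ge> 0"
  by (auto simp: path_lengths_def intro: has_integral_nonneg rnorm_nonneg)

lemma bdd_below_path_lengths: "continuous_metric g \<Longrightarrow> bdd_below (path_lengths g x y)"
  using path_lengths_nonneg by (meson bdd_belowI)

text \<open>A segment has a continuous speed, hence a length. This keeps \<open>path_lengths\<close>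
  nonempty, without which its \<open>Inf\<close> would say nothing, and it supplies the local upper
  bound for the distance.\<close>

lemma path_lengths_linepath:
  assumes g: "continuous_metric g"
  obtains L where "L \<in> path_lengths g x y"
    "\<And>K. (\<And>z v. z \<in> closed_segment x y \<Longrightarrow> rnorm g z v \<le> K * norm v) \<Longrightarrow> L \<le> K * dist x y"
proof -
  let ?f = "\<lambda>t. rnorm g (linepath x y t) (y - x)"
  have "continuous_on {0..1} ?f"
    by (rule continuous_on_rnorm[OF g]; intro continuous_intros)
  then have int: "(?f has_integral integral {0..1} ?f) {0..1}"
    using integrable_continuous_real integrable_integral by blast
  have "integral {0..1} ?f \<in> path_lengths g x y"
    unfolding path_lengths_def using int
    by (auto intro!: exI[of _ "linepath x y"])
  moreover have "integral {0..1} ?f \<le> K * dist x y"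
    if "\<And>z v. z \<in> closed_segment x y \<Longrightarrow> rnorm g z v \<le> K * norm v" for K
  proof (rule has_integral_le[OF int])
    show "((\<lambda>t. K * dist x y) has_integral K * dist x y) {0..1::real}"
      using has_integral_const_real[of "K * dist x y" 0 1] by simp
    show "?f t \<le> K * dist x y" if "t \<in> {0..1}" for t
      using \<open>\<And>z v. z \<in> closed_segment x y \<Longrightarrow> rnorm g z v \<le> K * norm v\<close> that
      by (metis dist_commute dist_norm linepath_in_path)
  qed
  ultimately show ?thesis using that by blast
qed

text \<open>The chain rule for the reversed path holds off the reflected break points. These are
  finitely many, so the integral does not see them.\<close>

lemma path_lengths_reverse:
  assumes g: "continuous_metric g" and L: "L \<in> path_lengths g x y"
  shows "L \<in> path_lengths g y x"
proof -
  obtain \<gamma> where \<gamma>: "valid_path \<gamma>" "pathstart \<gamma> = x" "pathfinish \<gamma> = y"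
    and int: "((\<lambda>t. rnorm g (\<gamma> t) (vector_derivative \<gamma> (at t))) has_integral L) {0..1}"
    using L by (auto simp: path_lengths_def)
  obtain S where S: "finite S" "\<And>t. t \<in> {0..1} - S \<Longrightarrow> \<gamma> differentiable (at t)"
    using \<gamma>(1) by (auto simp: valid_path_def piecewise_C1_differentiable_on_def C1_differentiable_on_eq)
  have deriv: "vector_derivative (\<lambda>t. \<gamma> (1 - t)) (at t) = - vector_derivative \<gamma> (at (1 - t))"
    if "t \<in> {0..1}" "1 - t \<notin> S" for t
  proof -
    have \<gamma>': "(\<gamma> has_vector_derivative vector_derivative \<gamma> (at (1 - t))) (at (1 - t))"
      using S(2) that by (auto simp: vector_derivative_works)
    have "(\<gamma> \<circ> (\<lambda>t. 1 - t) has_vector_derivative (-1) *\<^sub>R vector_derivative \<gamma> (at (1 - t))) (at t)"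
      by (intro vector_diff_chain_within has_vector_derivative_at_within[OF \<gamma>'] derivative_eq_intros | simp)+
    then show ?thesis by (simp add: o_def vector_derivative_at)
  qed
  have "((\<lambda>t. rnorm g (\<gamma> (1 - t)) (vector_derivative \<gamma> (at (1 - t)))) has_integral L) {0..1}"
    using has_integral_affinity01[where m = "-1" and c = 1, OF int] by simp
  then have "((\<lambda>t. rnorm g (reversepath \<gamma> t) (vector_derivative (reversepath \<gamma>) (at t))) has_integral L) {0..1}"
    unfolding reversepath_def
  proof (rule has_integral_spike_finite[where S = "(\<lambda>t. 1 - t) ` S", rotated 2])
    fix t :: real assume t: "t \<in> {0..1} - (\<lambda>t. 1 - t) ` S"
    then have "1 - t \<notin> S" by (auto simp: image_iff)
    then show "rnorm g (\<gamma> (1 - t)) (vector_derivative (\<lambda>t. \<gamma> (1 - t)) (at t)) =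
        rnorm g (\<gamma> (1 - t)) (vector_derivative \<gamma> (at (1 - t)))"
      using t deriv[of t] by (simp add: rnorm_minus[OF g])
  qed (use S(1) in auto)
  then show ?thesis
    unfolding path_lengths_def using \<gamma> by (auto intro!: exI[of _ "reversepath \<gamma>"])
qed

lemma path_lengths_join:
  assumes g: "continuous_metric g" and L1: "L1 \<in> path_lengths g x y" and L2: "L2 \<in> path_lengths g y z"
  shows "L1 + L2 \<in> path_lengths g x z"
proof -
  obtain \<gamma>1 where \<gamma>1: "valid_path \<gamma>1" "pathstart \<gamma>1 = x" "pathfinish \<gamma>1 = y"
    and int1: "((\<lambda>t. rnorm g (\<gamma>1 t) (vector_derivative \<gamma>1 (at t))) has_integral L1) {0..1}"
    using L1 by (auto simp: path_lengths_def)
  obtain \<gamma>2 where \<gamma>2: "valid_path \<gamma>2" "pathstart \<gamma>2 = y" "pathfinish \<gamma>2 = z"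
    and int2: "((\<lambda>t. rnorm g (\<gamma>2 t) (vector_derivative \<gamma>2 (at t))) has_integral L2) {0..1}"
    using L2 by (auto simp: path_lengths_def)
  obtain S1 where S1: "finite S1" "\<And>t. t \<in> {0..1} - S1 \<Longrightarrow> \<gamma>1 differentiable (at t)"
    using \<gamma>1(1) by (auto simp: valid_path_def piecewise_C1_differentiable_on_def C1_differentiable_on_eq)
  obtain S2 where S2: "finite S2" "\<And>t. t \<in> {0..1} - S2 \<Longrightarrow> \<gamma>2 differentiable (at t)"
    using \<gamma>2(1) by (auto simp: valid_path_def piecewise_C1_differentiable_on_def C1_differentiable_on_eq)
  let ?\<gamma> = "\<gamma>1 +++ \<gamma>2"
  let ?speed = "\<lambda>\<gamma> t. rnorm g (\<gamma> t) (vector_derivative \<gamma> (at t))"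
  have i1: "((\<lambda>t. 2 * ?speed \<gamma>1 (2*t)) has_integral L1) {0..1/2}"
   and i2: "((\<lambda>t. 2 * ?speed \<gamma>2 (2*t - 1)) has_integral L2) {1/2..1}"
    using has_integral_affinity01[OF int1, where m = 2 and c = 0, THEN has_integral_cmul[where c = 2]]
          has_integral_affinity01[OF int2, where m = 2 and c = "-1", THEN has_integral_cmul[where c = 2]]
    by (simp_all only: image_affinity_atLeastAtMost_div_diff) simp_all
  have d1: "vector_derivative ?\<gamma> (at t) = 2 *\<^sub>R vector_derivative \<gamma>1 (at (2*t))"
    if "0 \<le> t" "t < 1/2" "2*t \<notin> S1" for t
  proof (rule vector_derivative_at)
    have "(\<gamma>1 has_vector_derivative vector_derivative \<gamma>1 (at (2*t))) (at (2*t))"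
      using S1(2)[of "2*t"] that by (auto simp: vector_derivative_works)
    moreover have "((*) 2 has_vector_derivative 2) (at t)"
      by (simp add: has_vector_derivative_def has_derivative_def bounded_linear_mult_left)
    ultimately have "((\<lambda>t. \<gamma>1 (2*t)) has_vector_derivative 2 *\<^sub>R vector_derivative \<gamma>1 (at (2*t))) (at t)"
      by (intro vector_diff_chain_at[simplified o_def])
    then show "(?\<gamma> has_vector_derivative 2 *\<^sub>R vector_derivative \<gamma>1 (at (2*t))) (at t)"
      by (rule has_vector_derivative_transform_within_open[where S = "{..<1/2}"])
        (use that in \<open>auto simp: joinpaths_def\<close>)
  qed
  have d2: "vector_derivative ?\<gamma> (at t) = 2 *\<^sub>R vector_derivative \<gamma>2 (at (2*t - 1))"
    if "1/2 < t" "t \<le> 1" "2*t - 1 \<notin> S2" for t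
  proof (rule vector_derivative_at)
    have "(\<gamma>2 has_vector_derivative vector_derivative \<gamma>2 (at (2*t - 1))) (at (2*t - 1))"
      using S2(2)[of "2*t - 1"] that by (auto simp: vector_derivative_works)
    moreover have "((\<lambda>t. 2*t - 1) has_vector_derivative 2) (at t)"
      by (simp add: has_vector_derivative_def has_derivative_def bounded_linear_mult_left)
    ultimately have "((\<lambda>t. \<gamma>2 (2*t - 1)) has_vector_derivative 2 *\<^sub>R vector_derivative \<gamma>2 (at (2*t - 1))) (at t)"
      by (intro vector_diff_chain_at[simplified o_def])
    then show "(?\<gamma> has_vector_derivative 2 *\<^sub>R vector_derivative \<gamma>2 (at (2*t - 1))) (at t)"
      by (rule has_vector_derivative_transform_within_open[where S = "{1/2<..}"])
        (use that in \<open>auto simp: joinpaths_def\<close>)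
  qed
  have "(?speed ?\<gamma> has_integral L1) {0..1/2}"
  proof (rule has_integral_spike_finite[OF _ _ i1])
    \<comment> \<open>The junction \<open>1/2\<close> is excluded together with the break points,
      since the joined path may have a corner there. Elsewhere the doubled speed cancels the halved
      time.\<close>
    show "finite (insert (1/2) ((*) 2 -` S1))"
      using S1(1) by (force intro: finite_vimageI[where h = "(*) 2"] inj_onI)
    show "?speed ?\<gamma> t = 2 * ?speed \<gamma>1 (2*t)" if "t \<in> {0..1/2} - insert (1/2) ((*) 2 -` S1)" for t
      using that d1[of t] by (simp add: joinpaths_def rnorm_scaleR[OF g])
  qed
  moreover have "(?speed ?\<gamma> has_integral L2) {1/2..1}"
  proof (rule has_integral_spike_finite[OF _ _ i2])
    show "finite (insert (1/2) ((\<lambda>t. 2*t - 1) -` S2))"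
      using S2(1) by (force intro: finite_vimageI[where h = "\<lambda>t. 2*t - 1"] inj_onI)
    show "?speed ?\<gamma> t = 2 * ?speed \<gamma>2 (2*t - 1)" if "t \<in> {1/2..1} - insert (1/2) ((\<lambda>t. 2*t - 1) -` S2)" for t
      using that d2[of t] by (simp add: joinpaths_def rnorm_scaleR[OF g])
  qed
  ultimately have "(?speed ?\<gamma> has_integral L1 + L2) {0..1}"
    by (intro has_integral_combine[where c = "1/2"]) auto
  then show ?thesis
    unfolding path_lengths_def using \<gamma>1 \<gamma>2 by (auto intro!: exI[of _ ?\<gamma>] valid_path_join)
qed

text \<open>Follow the path up to the first time it reaches distance \<open>min r (dist x y)\<close> from \<open>x\<close>.\<close>

lemma path_lengths_lower:
  assumes g: "continuous_metric g" and L: "L \<in> path_lengths g x y" and "r > 0" "c > 0"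
    and lower: "\<And>z v. z \<in> cball x r \<Longrightarrow> c * norm v \<le> rnorm g z v"
  shows "c * min r (dist x y) \<le> L"
proof -
  obtain \<gamma> where \<gamma>: "valid_path \<gamma>" "pathstart \<gamma> = x" "pathfinish \<gamma> = y"
    and int: "((\<lambda>t. rnorm g (\<gamma> t) (vector_derivative \<gamma> (at t))) has_integral L) {0..1}"
    using L by (auto simp: path_lengths_def)
  have ends: "\<gamma> 0 = x" "\<gamma> 1 = y" using \<gamma> by (auto simp: pathstart_def pathfinish_def)
  have cont: "continuous_on {0..1} \<gamma>"
    using \<gamma>(1) valid_path_imp_path path_def by blast
  define \<rho> where "\<rho> = min r (dist x y)"
  have "\<rho> \<ge> 0" "\<rho> \<le> dist x y" "\<rho> \<le> r" using \<open>r > 0\<close> by (auto simp: \<rho>_def)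
  have cd: "continuous_on {0..1} (\<lambda>t. dist x (\<gamma> t))"
    by (intro continuous_intros cont)
  \<comment> \<open>A closed set of times, bounded below and nonempty, so its infimum is attained
    and is the first hitting time.\<close>
  define T where "T = {t \<in> {0..1}. dist x (\<gamma> t) = \<rho>}"
  have hit: "\<exists>s\<in>T. s \<le> t" if "t \<in> {0..1}" "\<rho> \<le> dist x (\<gamma> t)" for t
  proof -
    have "\<exists>s\<ge>0. s \<le> t \<and> dist x (\<gamma> s) = \<rho>"
      using that \<open>\<rho> \<ge> 0\<close> ends(1) by (intro IVT' continuous_on_subset[OF cd]) auto
    then show ?thesis using that by (auto simp: T_def)
  qed
  have "closed T"
    unfolding T_def by (rule continuous_closed_preimage_constant[OF cd]) simp
  moreover have "T \<noteq> {}" using hit[of 1] ends(2) \<open>\<rho> \<le> dist x y\<close> by auto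
  moreover have "bdd_below T" by (rule bdd_belowI[of _ 0]) (auto simp: T_def)
  ultimately have "Inf T \<in> T" by (intro closed_contains_Inf)
  define s where "s = Inf T"
  have s: "s \<in> {0..1}" "dist x (\<gamma> s) = \<rho>" using \<open>Inf T \<in> T\<close> by (auto simp: T_def s_def)
  \<comment> \<open>A point outside the ball would be preceded by a hit, by the intermediate value
    theorem, against the minimality of \<open>s\<close>.\<close>
  have inside: "dist x (\<gamma> t) \<le> r" if "t \<in> {0..s}" for t
  proof (rule ccontr)
    assume "\<not> dist x (\<gamma> t) \<le> r"
    then have "\<rho> \<le> dist x (\<gamma> t)" "t \<in> {0..1}" using that s(1) \<open>\<rho> \<le> r\<close> by auto
    then obtain s' where "s' \<in> T" "s' \<le> t" using hit[of t] by blast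
    moreover have "s \<le> s'" unfolding s_def using \<open>s' \<in> T\<close> \<open>bdd_below T\<close> by (rule cInf_lower)
    ultimately have "t = s" using that by simp
    then show False using s(2) \<open>\<rho> \<le> r\<close> \<open>\<not> dist x (\<gamma> t) \<le> r\<close> by simp
  qed
  obtain S where S: "finite S" "\<And>t. t \<in> {0..1} - S \<Longrightarrow> \<gamma> differentiable (at t)"
    using \<gamma>(1) by (auto simp: valid_path_def piecewise_C1_differentiable_on_def C1_differentiable_on_eq)
  have ftc: "((\<lambda>t. vector_derivative \<gamma> (at t)) has_integral (\<gamma> s - \<gamma> 0)) {0..s}"
    using s(1) S by (intro fundamental_theorem_of_calculus_interior_strong[of S] continuous_on_subset[OF cont])
      (auto simp: vector_derivative_works)
  let ?h = "\<lambda>t. rnorm g (\<gamma> t) (vector_derivative \<gamma> (at t))"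
  have hint: "?h integrable_on {0..1}" using int by blast
  have hint': "?h integrable_on {0..s}"
    by (rule integrable_on_subinterval[OF hint]) (use s in auto)
  \<comment> \<open>The chord from \<open>x\<close> to \<open>\<gamma> s\<close> is the integral of
    the velocity, and inside the ball \<open>c\<close> times its norm is dominated by the
    speed.\<close>
  have "norm (integral {0..s} (\<lambda>t. c *\<^sub>R vector_derivative \<gamma> (at t))) \<le> integral {0..s} ?h"
  proof (rule Henstock_Kurzweil_Integration.integral_norm_bound_integral[OF _ hint'])
    show "(\<lambda>t. c *\<^sub>R vector_derivative \<gamma> (at t)) integrable_on {0..s}"
      using ftc by (intro integrable_cmul) blast
    show "norm (c *\<^sub>R vector_derivative \<gamma> (at t)) \<le> ?h t" if "t \<in> {0..s}" for t
      using lower[of "\<gamma> t"] inside[OF that] \<open>c > 0\<close> by simp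
  qed
  also have "integral {0..s} (\<lambda>t. c *\<^sub>R vector_derivative \<gamma> (at t)) = c *\<^sub>R (\<gamma> s - x)"
    using ftc ends(1) by (simp add: integral_unique)
  also have "integral {0..s} ?h \<le> integral {0..1} ?h"
    by (rule integral_subset_le[OF _ hint' hint]) (use s rnorm_nonneg[OF g] in auto)
  also have "integral {0..1} ?h = L" using int by (rule integral_unique)
  finally show ?thesis
    using s(2) \<open>c > 0\<close> by (simp add: \<rho>_def dist_norm norm_minus_commute)
qed

text \<open>The same path serves for both metrics, but the existence of its \<open>g1\<close>-length
  needs an argument because the speed may be unbounded near break points. Off the break points the
  \<open>g1\<close>-speed is continuous, hence measurable, and it is dominated by an integrable
  function.\<close>

lemma path_lengths_mono:
  assumes g1: "continuous_metric g1" and g2: "continuous_metric g2"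
    and le: "\<And>x v. rnorm g1 x v \<le> K * rnorm g2 x v" and L: "L \<in> path_lengths g2 x y"
  obtains L' where "L' \<in> path_lengths g1 x y" "L' \<le> K * L"
proof -
  obtain \<gamma> where \<gamma>: "valid_path \<gamma>" "pathstart \<gamma> = x" "pathfinish \<gamma> = y"
    and int: "((\<lambda>t. rnorm g2 (\<gamma> t) (vector_derivative \<gamma> (at t))) has_integral L) {0..1}"
    using L by (auto simp: path_lengths_def)
  obtain S where S: "finite S" "continuous_on ({0..1} - S) (\<lambda>t. vector_derivative \<gamma> (at t))"
    using \<gamma>(1) by (auto simp: valid_path_def piecewise_C1_differentiable_on_def C1_differentiable_on_eq)
  have cont: "continuous_on {0..1} \<gamma>"
    using \<gamma>(1) valid_path_imp_path path_def by blast
  let ?h = "\<lambda>g t. rnorm g (\<gamma> t) (vector_derivative \<gamma> (at t))"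
  have eq: "f integrable_on {0..1} - S \<longleftrightarrow> f integrable_on {0..1}" for f :: "real \<Rightarrow> real"
    by (rule integrable_spike_set_eq) (use S(1) in \<open>auto intro: negligible_subset[of S]\<close>)
  have "?h g1 integrable_on {0..1} - S"
  proof (rule measurable_bounded_by_integrable_imp_integrable)
    have "continuous_on ({0..1} - S) (?h g1)"
      by (intro continuous_on_rnorm[OF g1] S(2) continuous_on_subset[OF cont]) auto
    moreover show "{0..1} - S \<in> sets lebesgue"
      using S(1) by (intro sets.Diff) (auto intro: negligible_imp_sets)
    ultimately show "?h g1 \<in> borel_measurable (lebesgue_on ({0..1} - S))"
      by (rule continuous_imp_measurable_on_sets_lebesgue)
    have "(\<lambda>t. K * ?h g2 t) integrable_on {0..1}"
      using has_integral_mult_right[OF int, of K] by blast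
    then show "(\<lambda>t. K * ?h g2 t) integrable_on {0..1} - S" by (simp only: eq)
    show "norm (?h g1 t) \<le> K * ?h g2 t" for t
      using le[of "\<gamma> t"] rnorm_nonneg[OF g1] by simp
  qed
  then have int1: "(?h g1 has_integral integral {0..1} (?h g1)) {0..1}"
    by (simp only: eq integrable_integral)
  then have "integral {0..1} (?h g1) \<in> path_lengths g1 x y"
    unfolding path_lengths_def using \<gamma> by blast
  moreover have "integral {0..1} (?h g1) \<le> K * L"
    using int1 has_integral_mult_right[OF int, of K] by (rule has_integral_le) (rule le)
  ultimately show ?thesis by (rule that)
qed

lemma riemannian_dist_mono:
  assumes g1: "continuous_metric g1" and g2: "continuous_metric g2" and "K > 0"
    and le: "\<And>x v. rnorm g1 x v \<le> K * rnorm g2 x v"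
  shows "riemannian_dist g1 x y \<le> K * riemannian_dist g2 x y"
proof -
  have "riemannian_dist g1 x y / K \<le> Inf (path_lengths g2 x y)"
  proof (rule cInf_greatest)
    show "path_lengths g2 x y \<noteq> {}" using path_lengths_linepath[OF g2] by blast
    fix L assume "L \<in> path_lengths g2 x y"
    then obtain L' where "L' \<in> path_lengths g1 x y" "L' \<le> K * L"
      using path_lengths_mono[OF g1 g2 le] by blast
    then have "riemannian_dist g1 x y \<le> K * L"
      unfolding riemannian_dist_eq using cInf_lower bdd_below_path_lengths[OF g1] by (meson order_trans)
    then show "riemannian_dist g1 x y / K \<le> L" using \<open>K > 0\<close> by (simp add: field_simps)
  qed
  then show ?thesis using \<open>K > 0\<close> by (simp add: riemannian_dist_eq field_simps)
qed

text \<open>The constant depends on \<open>x\<close>, since the metric is bounded below only on the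
  unit ball around it. Truncating at \<open>1\<close> loses nothing for separating points and
  detecting limits.\<close>

lemma riemannian_dist_lower:
  assumes g: "continuous_metric g"
  obtains c where "c > 0" "\<And>y. c * min 1 (dist x y) \<le> riemannian_dist g x y"
proof -
  obtain m where m: "m > 0" "\<And>z v. z \<in> cball x 1 \<Longrightarrow> m * (norm v)\<^sup>2 \<le> g z v v"
    using continuous_metric_compact_lower[OF g compact_cball] by blast
  have le: "sqrt m * norm v \<le> rnorm g z v" if "z \<in> cball x 1" for z v
    using real_sqrt_le_mono[OF m(2)[OF that, of v]] by (simp add: rnorm_def real_sqrt_mult)
  have "sqrt m * min 1 (dist x y) \<le> riemannian_dist g x y" for y
    unfolding riemannian_dist_eq
  proof (rule cInf_greatest)
    show "path_lengths g x y \<noteq> {}" using path_lengths_linepath[OF g] by blast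
    show "sqrt m * min 1 (dist x y) \<le> L" if "L \<in> path_lengths g x y" for L
      by (rule path_lengths_lower[OF g that]) (use m(1) le in auto)
  qed
  then show ?thesis using m(1) that[of "sqrt m"] by simp
qed

lemma riemannian_dist_upper:
  assumes g: "continuous_metric g"
  obtains c where "c > 0" "\<And>y. dist x y \<le> 1 \<Longrightarrow> riemannian_dist g x y \<le> c * dist x y"
proof -
  obtain m where m: "m > 0" "\<And>z v. z \<in> cball x 1 \<Longrightarrow> g z v v \<le> m * (norm v)\<^sup>2"
    using continuous_metric_compact_upper[OF g compact_cball] by blast
  have le: "rnorm g z v \<le> sqrt m * norm v" if "z \<in> cball x 1" for z v
    using real_sqrt_le_mono[OF m(2)[OF that, of v]] by (simp add: rnorm_def real_sqrt_mult)
  have "riemannian_dist g x y \<le> sqrt m * dist x y" if y: "dist x y \<le> 1" for y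
  proof -
    obtain L where L: "L \<in> path_lengths g x y"
      "\<And>K. (\<And>z v. z \<in> closed_segment x y \<Longrightarrow> rnorm g z v \<le> K * norm v) \<Longrightarrow> L \<le> K * dist x y"
      using path_lengths_linepath[OF g] by blast
    have "closed_segment x y \<subseteq> cball x 1"
      using y by (intro closed_segment_subset) auto
    then have "L \<le> sqrt m * dist x y" using le by (intro L(2)) blast
    moreover have "riemannian_dist g x y \<le> L"
      unfolding riemannian_dist_eq using L(1) bdd_below_path_lengths[OF g] by (rule cInf_lower)
    ultimately show ?thesis by simp
  qed
  then show ?thesis using m(1) that[of "sqrt m"] by simp
qed

lemma riemannian_dist_commute: "continuous_metric g \<Longrightarrow> riemannian_dist g x y = riemannian_dist g y x"
  unfolding riemannian_dist_eq using path_lengths_reverse by (metis subsetI subset_antisym)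

lemma riemannian_dist_triangle:
  assumes g: "continuous_metric g"
  shows "riemannian_dist g x z \<le> riemannian_dist g x y + riemannian_dist g y z"
proof -
  have ne: "path_lengths g u v \<noteq> {}" for u v using path_lengths_linepath[OF g] by blast
  have "riemannian_dist g x z - L \<le> Inf (path_lengths g y z)" if L: "L \<in> path_lengths g x y" for L
  proof (rule cInf_greatest[OF ne])
    fix L' assume "L' \<in> path_lengths g y z"
    then have "Inf (path_lengths g x z) \<le> L + L'"
      using path_lengths_join[OF g L] bdd_below_path_lengths[OF g] by (intro cInf_lower) auto
    then show "riemannian_dist g x z - L \<le> L'" by (simp add: riemannian_dist_eq)
  qed
  then have "riemannian_dist g x z - riemannian_dist g y z \<le> Inf (path_lengths g x y)"
    by (intro cInf_greatest[OF ne]) (force simp: riemannian_dist_eq)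
  then show ?thesis by (simp add: riemannian_dist_eq)
qed

lemma riemannian_dist_nonneg:
  assumes g: "continuous_metric g"
  shows "riemannian_dist g x y \<ge> 0"
  unfolding riemannian_dist_eq
proof (rule cInf_greatest)
  show "path_lengths g x y \<noteq> {}" using path_lengths_linepath[OF g] by blast
qed (rule path_lengths_nonneg[OF g])

lemma Metric_space_riemannian_dist:
  assumes g: "continuous_metric g"
  shows "Metric_space UNIV (riemannian_dist g)"
proof
  fix x y z
  show "riemannian_dist g x y \<ge> 0" by (rule riemannian_dist_nonneg[OF g])
  show "riemannian_dist g x y = riemannian_dist g y x" by (rule riemannian_dist_commute[OF g])
  show "riemannian_dist g x z \<le> riemannian_dist g x y + riemannian_dist g y z"
    by (rule riemannian_dist_triangle[OF g])
  show "riemannian_dist g x y = 0 \<longleftrightarrow> x = y"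
  proof
    assume 0: "riemannian_dist g x y = 0"
    obtain c where "c > 0" "c * min 1 (dist x y) \<le> riemannian_dist g x y"
      using riemannian_dist_lower[OF g] by blast
    then have "min 1 (dist x y) \<le> 0" using 0 by (metis mult_pos_pos not_le)
    then show "x = y" using min_le_iff_disj[of 1 "dist x y" 0] by simp
  next
    assume "x = y"
    moreover obtain c where "riemannian_dist g x x \<le> c * dist x x"
      using riemannian_dist_upper[OF g, of x] by (metis dist_self zero_le_one)
    ultimately show "riemannian_dist g x y = 0"
      using riemannian_dist_nonneg[OF g, of x x] by simp
  qed
qed

text \<open>Every such distance induces the Euclidean convergence, so a limit found for one metric
  is also a limit for another.\<close>

lemma limitin_riemannian_dist:
  assumes g: "continuous_metric g"
  shows "limitin (Metric_space.mtopology UNIV (riemannian_dist g)) \<sigma> x sequentially \<longleftrightarrow> \<sigma> \<longlonglongrightarrow> x"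
proof -
  interpret Metric_space UNIV "riemannian_dist g" by (rule Metric_space_riemannian_dist[OF g])
  obtain c where c: "c > 0" "\<And>y. c * min 1 (dist x y) \<le> riemannian_dist g x y"
    using riemannian_dist_lower[OF g] by blast
  obtain C where C: "C > 0" "\<And>y. dist x y \<le> 1 \<Longrightarrow> riemannian_dist g x y \<le> C * dist x y"
    using riemannian_dist_upper[OF g] by blast
  have "\<exists>N. \<forall>n\<ge>N. dist (\<sigma> n) x < e"
    if "e > 0" and lim: "\<forall>\<epsilon>>0. \<exists>N. \<forall>n\<ge>N. riemannian_dist g (\<sigma> n) x < \<epsilon>" for e
  proof -
    have "c * min 1 e > 0" using c(1) \<open>e > 0\<close> by simp
    then obtain N where N: "\<forall>n\<ge>N. riemannian_dist g (\<sigma> n) x < c * min 1 e" using lim by blast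
    have "dist (\<sigma> n) x < e" if "n \<ge> N" for n
    proof -
      have "c * min 1 (dist x (\<sigma> n)) < c * min 1 e"
        using c(2)[of "\<sigma> n"] N that commute[of "\<sigma> n" x] by (metis le_less_trans)
      then have "min 1 (dist x (\<sigma> n)) < min 1 e" using c(1) by simp
      then show ?thesis by (simp add: dist_commute min_def split: if_splits)
    qed
    then show ?thesis by blast
  qed
  moreover have "\<exists>N. \<forall>n\<ge>N. riemannian_dist g (\<sigma> n) x < e"
    if "e > 0" and lim: "\<forall>\<epsilon>>0. \<exists>N. \<forall>n\<ge>N. dist (\<sigma> n) x < \<epsilon>" for e
  proof -
    have "min 1 (e / C) > 0" using C(1) \<open>e > 0\<close> by simp
    then obtain N where N: "\<forall>n\<ge>N. dist (\<sigma> n) x < min 1 (e / C)" using lim by blast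
    have "riemannian_dist g (\<sigma> n) x < e" if "n \<ge> N" for n
    proof -
      have *: "dist x (\<sigma> n) < min 1 (e / C)" using N that by (simp add: dist_commute)
      then have "riemannian_dist g x (\<sigma> n) \<le> C * dist x (\<sigma> n)" by (intro C(2)) simp
      also have "\<dots> < e" using * C(1) by (simp add: field_simps)
      finally show ?thesis by (simp add: commute)
    qed
    then show ?thesis by blast
  qed
  ultimately show ?thesis
    unfolding limit_metric_sequentially lim_sequentially by auto
qed

text \<open>Cauchy sequences of the larger distance are Cauchy for the smaller one. Their limit
  there is a Euclidean limit and hence a limit for the larger distance too.\<close>

lemma complete_metric_mono:
  assumes g1: "complete_riemannian_metric g1" and g2: "riemannian_metric g2" and "K > 0"
    and le: "\<And>x v. g1 x v v \<le> K * g2 x v v"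
  shows "complete_riemannian_metric g2"
proof -
  have c1: "continuous_metric g1" and c2: "continuous_metric g2"
    using g1 g2 by (auto simp: complete_riemannian_metric_def riemannian_imp_continuous_metric)
  interpret M1: Metric_space UNIV "riemannian_dist g1" by (rule Metric_space_riemannian_dist[OF c1])
  interpret M2: Metric_space UNIV "riemannian_dist g2" by (rule Metric_space_riemannian_dist[OF c2])
  have K: "sqrt K > 0" using \<open>K > 0\<close> by simp
  have "rnorm g1 x v \<le> sqrt K * rnorm g2 x v" for x v
    using real_sqrt_le_mono[OF le[of x v]] by (simp add: rnorm_def real_sqrt_mult)
  then have d: "riemannian_dist g1 x y \<le> sqrt K * riemannian_dist g2 x y" for x y
    using riemannian_dist_mono[OF c1 c2 K] by blast
  have "\<exists>x. limitin M2.mtopology \<sigma> x sequentially" if \<sigma>: "M2.MCauchy \<sigma>" for \<sigma>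
  proof -
    have "M1.MCauchy \<sigma>"
      unfolding M1.MCauchy_def
    proof (intro conjI allI impI)
      fix e :: real assume "e > 0"
      then have "e / sqrt K > 0" using K by simp
      then obtain N where N: "\<And>n n'. N \<le> n \<Longrightarrow> N \<le> n' \<Longrightarrow> riemannian_dist g2 (\<sigma> n) (\<sigma> n') < e / sqrt K"
        using \<sigma> unfolding M2.MCauchy_def by blast
      have "riemannian_dist g1 (\<sigma> n) (\<sigma> n') < e" if "N \<le> n" "N \<le> n'" for n n'
      proof -
        have "sqrt K * riemannian_dist g2 (\<sigma> n) (\<sigma> n') < e"
          using N[OF that] K by (simp add: field_simps)
        then show ?thesis using d[of "\<sigma> n" "\<sigma> n'"] by simp
      qed
      then show "\<exists>N. \<forall>n n'. N \<le> n \<longrightarrow> N \<le> n' \<longrightarrow> riemannian_dist g1 (\<sigma> n) (\<sigma> n') < e" by blast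
    qed simp
    then have "\<exists>x. limitin M1.mtopology \<sigma> x sequentially"
      using g1 by (simp add: complete_riemannian_metric_def M1.mcomplete_def)
    then show ?thesis by (simp add: limitin_riemannian_dist c1 c2)
  qed
  then show ?thesis using g2 by (simp add: complete_riemannian_metric_def M2.mcomplete_def)
qed


section \<open>Closed families of subspaces and continuous subbundles\<close>

text \<open>The tube lemma. With \<open>K\<close> a unit sphere it says that an open condition on
  base point and vector, imposed on all unit vectors, is open in the base point.\<close>

lemma open_compact_Ball:
  assumes K: "compact K" and V: "open V"
  shows "open {x. \<forall>k\<in>K. (x, k) \<in> V}"
proof (subst open_subopen, intro ballI)
  fix x assume "x \<in> {x. \<forall>k\<in>K. (x, k) \<in> V}"
  then have "{x} \<times> K \<subseteq> V" by auto
  then obtain A B where "open A" "x \<in> A" "K \<subseteq> B" "A \<times> B \<subseteq> V"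
    using tube_lemma_right[of euclidean euclidean V K x] K V
    by (auto simp: euclidean_product_topology)
  then show "\<exists>T. open T \<and> x \<in> T \<and> T \<subseteq> {x. \<forall>k\<in>K. (x, k) \<in> V}"
    by (intro exI[of _ A]) auto
qed

lemma continuous_on_linear_family:
  fixes T :: "'x::topological_space \<Rightarrow> 'a::euclidean_space \<Rightarrow> 'b::real_normed_vector"
  assumes lin: "\<And>x. x \<in> U \<Longrightarrow> linear (T x)" and cont: "\<And>v. continuous_on U (\<lambda>x. T x v)"
    and a: "continuous_on S a" "a ` S \<subseteq> U" and b: "continuous_on S b"
  shows "continuous_on S (\<lambda>s. T (a s) (b s))"
proof -
  have "continuous_on S (\<lambda>s. \<Sum>i\<in>Basis. (b s \<bullet> i) *\<^sub>R T (a s) i)"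
    by (intro continuous_on_sum continuous_on_scaleR continuous_on_inner continuous_on_const b
        continuous_on_compose2[OF cont a(1) a(2)])
  moreover have "(\<Sum>i\<in>Basis. (b s \<bullet> i) *\<^sub>R T (a s) i) = T (a s) (b s)" if "s \<in> S" for s
  proof -
    have l: "linear (T (a s))" using lin a(2) that by blast
    have "(\<Sum>i\<in>Basis. (b s \<bullet> i) *\<^sub>R T (a s) i) = T (a s) (\<Sum>i\<in>Basis. (b s \<bullet> i) *\<^sub>R i)"
      by (simp add: linear_sum[OF l] linear_cmul[OF l])
    then show ?thesis by (simp add: euclidean_representation)
  qed
  ultimately show ?thesis by (rule continuous_on_eq)
qed

text \<open>Closedness of the total space is a frame-free, semicontinuous substitute for continuity.
  It is easy to check for spaces given by closed conditions, and for two complementary families it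
  already yields continuity.\<close>

definition closed_family :: "('a::euclidean_space \<Rightarrow> 'a set) \<Rightarrow> bool" where
  "closed_family E \<longleftrightarrow> (\<forall>x. subspace (E x)) \<and> closed {(x, v). v \<in> E x}"

lemma closed_family_closed_Collect:
  assumes "closed_family E" "continuous_on UNIV a" "continuous_on UNIV b"
  shows "closed {z. b z \<in> E (a z)}"
proof -
  have "closed ((\<lambda>z. (a z, b z)) -` {(x, v). v \<in> E x})"
    using assms by (intro closed_vimage continuous_on_Pair) (auto simp: closed_family_def)
  moreover have "(\<lambda>z. (a z, b z)) -` {(x, v). v \<in> E x} = {z. b z \<in> E (a z)}" by auto
  ultimately show ?thesis by simp
qed

text \<open>The projection onto \<open>E x\<close> along \<open>F x\<close>. The description is
  meaningful once the two spaces are complementary, as in the locale below.\<close>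

definition split_proj :: "('a::euclidean_space \<Rightarrow> 'a set) \<Rightarrow> ('a \<Rightarrow> 'a set) \<Rightarrow> 'a \<Rightarrow> 'a \<Rightarrow> 'a" where
  "split_proj E F x v = (THE s. s \<in> E x \<and> v - s \<in> F x)"

locale splitting =
  fixes E F :: "'a::euclidean_space \<Rightarrow> 'a set"
  assumes closed_E: "closed_family E" and closed_F: "closed_family F"
    and inter: "\<And>x. E x \<inter> F x = {0}" and sum_ex: "\<And>x w. \<exists>u\<in>E x. \<exists>v\<in>F x. w = u + v"
begin

lemma subspace_E: "subspace (E x)" and subspace_F: "subspace (F x)"
  using closed_E closed_F by (auto simp: closed_family_def)

lemma split_proj_ex1: "\<exists>!s. s \<in> E x \<and> v - s \<in> F x"
proof (rule ex_ex1I)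
  show "\<exists>s. s \<in> E x \<and> v - s \<in> F x" using sum_ex[where x = x and w = v] by auto
  fix s t assume s: "s \<in> E x \<and> v - s \<in> F x" and t: "t \<in> E x \<and> v - t \<in> F x"
  then have "s - t \<in> E x" by (simp add: subspace_diff subspace_E)
  moreover have "(v - t) - (v - s) \<in> F x" using s t subspace_diff subspace_F by blast
  then have "s - t \<in> F x" by simp
  ultimately show "s = t" using inter by (metis IntI empty_iff insert_iff right_minus_eq)
qed

lemma split_proj_in: "split_proj E F x v \<in> E x"
  and split_proj_compl: "v - split_proj E F x v \<in> F x"
  using theI'[OF split_proj_ex1] unfolding split_proj_def by blast+

lemma split_proj_eqI: "s \<in> E x \<Longrightarrow> v - s \<in> F x \<Longrightarrow> split_proj E F x v = s"
  unfolding split_proj_def using split_proj_ex1 by (intro the1_equality) auto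

lemma split_proj_E: "v \<in> E x \<Longrightarrow> split_proj E F x v = v"
  by (rule split_proj_eqI) (auto simp: subspace_F subspace_0)

lemma split_proj_F: "v \<in> F x \<Longrightarrow> split_proj E F x v = 0"
  by (rule split_proj_eqI) (auto simp: subspace_E subspace_0)

lemma linear_split_proj: "linear (split_proj E F x)"
proof (rule linearI)
  fix v w c
  have "(v + w) - (split_proj E F x v + split_proj E F x w) =
      (v - split_proj E F x v) + (w - split_proj E F x w)" by simp
  then show "split_proj E F x (v + w) = split_proj E F x v + split_proj E F x w"
    by (metis split_proj_eqI split_proj_in split_proj_compl subspace_E subspace_F subspace_add)
  have "c *\<^sub>R v - c *\<^sub>R split_proj E F x v = c *\<^sub>R (v - split_proj E F x v)"
    by (simp add: scaleR_diff_right)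
  then show "split_proj E F x (c *\<^sub>R v) = c *\<^sub>R split_proj E F x v"
    by (metis split_proj_eqI split_proj_in split_proj_compl subspace_E subspace_F subspace_scale)
qed

lemma dim_add: "dim (E x) + dim (F x) = DIM('a)"
proof -
  have "{u + v |u v. u \<in> E x \<and> v \<in> F x} = UNIV" using sum_ex[of x] by blast
  then show ?thesis using dim_sums_Int[OF subspace_E subspace_F, of x x] inter[of x] by simp
qed

text \<open>A large projection means a unit vector of \<open>E x\<close> almost cancelled by a
  vector of \<open>F x\<close>. If this happened for base points tending to \<open>p\<close>,
  closedness would produce a nonzero common vector of \<open>E p\<close> and
  \<open>F p\<close>.\<close>

lemma split_proj_locally_bounded:
  obtains e K where "e > 0" "K > 0"
    "\<And>x v. dist p x < e \<Longrightarrow> norm (split_proj E F x v) \<le> K * norm v"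
proof -
  \<comment> \<open>The first component is normalised, and a second component of norm above
    \<open>2\<close> already leaves a sum of norm at least \<open>1\<close>; so a compact set of
    pairs suffices. The real coordinate in \<open>?V\<close> is the candidate lower bound for the
    norm of the sum.\<close>
  let ?K = "sphere (0::'a) 1 \<times> cball (0::'a) 2"
  let ?V = "{z :: ('a \<times> real) \<times> ('a \<times> 'a). \<not> (fst (snd z) \<in> E (fst (fst z)) \<and>
      snd (snd z) \<in> F (fst (fst z)) \<and> norm (fst (snd z) + snd (snd z)) \<le> snd (fst z))}"
  have "closed (- ?V)"
    by (simp add: Collect_neg_eq[symmetric])
      (intro closed_Collect_conj closed_family_closed_Collect[OF closed_E]
        closed_family_closed_Collect[OF closed_F] closed_Collect_le continuous_intros)
  then have "open ?V" using open_closed by blast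
  moreover have "compact ?K" by (simp add: compact_Times)
  ultimately have op: "open {z. \<forall>k\<in>?K. (z, k) \<in> ?V}" by (intro open_compact_Ball)
  have "(p, 0) \<in> {z. \<forall>k\<in>?K. (z, k) \<in> ?V}"
  proof -
    have "s = 0" if "s \<in> E p" "t \<in> F p" "s + t = 0" for s t
    proof -
      have "s = - t" using that(3) by (simp add: eq_neg_iff_add_eq_0)
      then have "s \<in> F p" using that(2) subspace_neg subspace_F by blast
      then show ?thesis using that(1) inter by blast
    qed
    then show ?thesis by force
  qed
  then obtain e where e: "e > 0" "ball (p, 0) e \<subseteq> {z. \<forall>k\<in>?K. (z, k) \<in> ?V}"
    using op open_contains_ball by blast
  define \<delta> where "\<delta> = min 1 (e / 2)"
  have \<delta>: "\<delta> > 0" "\<delta> \<le> 1" "\<delta> \<le> e / 2" using e(1) by (auto simp: \<delta>_def)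
  have "norm (split_proj E F x v) \<le> (1 / \<delta>) * norm v" if x: "dist p x < e / 2" for x v
  proof (cases "split_proj E F x v = 0")
    case False
    define s where "s = split_proj E F x v"
    have s: "s \<in> E x" "v - s \<in> F x" "norm s > 0"
      using False by (auto simp: s_def split_proj_in split_proj_compl)
    let ?s = "(1 / norm s) *\<^sub>R s" and ?t = "(1 / norm s) *\<^sub>R (v - s)"
    have st: "?s \<in> E x" "?t \<in> F x" "norm ?s = 1"
      using s by (simp_all add: subspace_scale subspace_E subspace_F)
    have sum: "?s + ?t = (1 / norm s) *\<^sub>R v" by (simp add: scaleR_diff_right)
    have "\<delta> \<le> norm (?s + ?t)"
    proof (cases "norm ?t \<le> 2")
      case True
      have "dist (p, 0) (x, \<delta>) \<le> dist p x + dist 0 \<delta>" by (simp only: dist_Pair_Pair sqrt_sum_squares_le_sum zero_le_dist)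
      then have "(x, \<delta>) \<in> ball (p, 0) e" using x \<delta> by (simp add: dist_real_def)
      then have "\<forall>k\<in>?K. ((x, \<delta>), k) \<in> ?V" using e(2) by blast
      moreover have "(?s, ?t) \<in> ?K" using st True by simp
      ultimately have "((x, \<delta>), (?s, ?t)) \<in> ?V" by blast
      then show ?thesis using st by simp
    next
      case False
      have "norm ?t \<le> norm (?s + ?t) + norm ?s"
        by (metis add_diff_cancel_left' norm_triangle_ineq4)
      then show ?thesis using False st(3) \<delta>(2) by linarith
    qed
    then have "\<delta> \<le> norm v / norm s" unfolding sum by simp
    then show ?thesis using s(3) \<delta>(1) by (simp add: s_def[symmetric] field_simps)
  qed (use \<delta>(1) in simp)
  then show ?thesis using that[of "e / 2" "1 / \<delta>"] e(1) \<delta>(1) by simp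
qed

text \<open>The graph is cut out by the conditions \<open>s\<close> in \<open>E x\<close> and
  \<open>v - s\<close> in \<open>F x\<close>, hence closed. Local boundedness confines it to a
  compact target, where a closed graph means continuity.\<close>

lemma continuous_split_proj: "continuous_on UNIV (\<lambda>x. split_proj E F x v)"
proof -
  have "isCont (\<lambda>x. split_proj E F x v) p" for p
  proof -
    obtain e K where e: "e > 0" and K: "K > 0"
      and bd: "\<And>x v. dist p x < e \<Longrightarrow> norm (split_proj E F x v) \<le> K * norm v"
      using split_proj_locally_bounded by blast
    let ?S = "cball p (e / 2)"
    have "continuous_on ?S (\<lambda>x. split_proj E F x v)"
    proof (rule continuous_from_closed_graph)
      show "compact (cball (0::'a) (K * norm v))" by simp
      show "(\<lambda>x. split_proj E F x v) \<in> ?S \<rightarrow> cball 0 (K * norm v)"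
        using bd e by auto
      have "(\<lambda>x. (x, split_proj E F x v)) ` ?S =
          {z. fst z \<in> ?S} \<inter> {z. snd z \<in> E (fst z)} \<inter> {z. v - snd z \<in> F (fst z)}"
        using split_proj_in split_proj_compl split_proj_eqI by (force simp: image_iff)
      also have "closed \<dots>"
      proof (intro closed_Int)
        show "closed {z :: 'a \<times> 'a. fst z \<in> ?S}"
          using closed_vimage_fst[OF closed_cball] by (simp only: vimage_def)
      qed (intro closed_family_closed_Collect closed_E closed_F continuous_intros)+
      finally show "closed ((\<lambda>x. (x, split_proj E F x v)) ` ?S)" .
    qed
    then show ?thesis
      using e by (intro continuous_on_interior[of ?S]) (auto simp: interior_cball)
  qed
  then show ?thesis by (simp add: continuous_on_eq_continuous_at)
qed

lemma splitting_swap: "splitting F E"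
proof
  show "F x \<inter> E x = {0}" for x using inter by blast
  show "\<exists>u\<in>F x. \<exists>v\<in>E x. w = u + v" for x w using sum_ex[of x w] by (metis add.commute)
qed (use closed_E closed_F in auto)

text \<open>A basis of \<open>E p\<close> is projected into the nearby spaces \<open>E x\<close>.
  The projection is injective on \<open>E p\<close> for \<open>x\<close> near \<open>p\<close>, and
  the constant dimension makes the images span.\<close>

lemma continuous_subbundle_E:
  assumes dim: "\<And>x. dim (E x) = k"
  shows "continuous_subbundle E"
  unfolding continuous_subbundle_def
proof
  fix p
  let ?P = "split_proj E F"
  obtain B where B: "B \<subseteq> E p" "independent B" "E p \<subseteq> span B" "card B = dim (E p)"
    using basis_exists by blast
  have spanB: "span B = E p"
    using B(1,3) span_minimal[OF B(1) subspace_E] by blast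
  have "finite B" using B(2) by (rule independent_imp_finite)
  then obtain b where b: "bij_betw b {..<k} B"
    using ex_bij_betw_nat_finite[of B] B(4) dim by (auto simp: lessThan_atLeast0)
  \<comment> \<open>Base points where the projection kills no unit vector of \<open>E p\<close>.
    Compactness of that sphere makes the set open.\<close>
  define U where "U = {x. \<forall>w\<in>sphere 0 1 \<inter> E p. (x, w) \<in> {z. ?P (fst z) (snd z) \<noteq> 0}}"
  have "open U"
    unfolding U_def
  proof (rule open_compact_Ball)
    show "compact (sphere 0 1 \<inter> E p)"
      by (intro compact_Int_closed compact_sphere closed_subspace subspace_E)
    have "continuous_on UNIV (\<lambda>z::'a \<times> 'a. ?P (fst z) (snd z))"
      by (rule continuous_on_linear_family[where U = UNIV])
        (auto intro: linear_split_proj continuous_split_proj continuous_intros)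
    then show "open {z::'a \<times> 'a. ?P (fst z) (snd z) \<noteq> 0}"
      by (intro open_Collect_neq continuous_on_const)
  qed
  moreover have "p \<in> U" by (auto simp: U_def split_proj_E)
  moreover have "inj_on (\<lambda>i. ?P x (b i)) {..<k} \<and> independent ((\<lambda>i. ?P x (b i)) ` {..<k}) \<and>
      E x = span ((\<lambda>i. ?P x (b i)) ` {..<k})" if "x \<in> U" for x
  proof -
    have "w = 0" if "w \<in> E p" "?P x w = 0" for w
    proof (rule ccontr)
      assume "w \<noteq> 0"
      then have "(1 / norm w) *\<^sub>R w \<in> sphere 0 1 \<inter> E p"
        using \<open>w \<in> E p\<close> by (simp add: subspace_scale subspace_E)
      then have "?P x ((1 / norm w) *\<^sub>R w) \<noteq> 0" using \<open>x \<in> U\<close> by (auto simp: U_def)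
      then show False using \<open>?P x w = 0\<close> by (simp add: linear_cmul[OF linear_split_proj])
    qed
    then have inj: "inj_on (?P x) (span B)"
      by (subst linear_inj_on_iff_eq_0[OF linear_split_proj subspace_span]) (auto simp: spanB)
    have img: "(\<lambda>i. ?P x (b i)) ` {..<k} = ?P x ` B"
      using b by (auto simp: bij_betw_def image_image[symmetric])
    have ind: "independent (?P x ` B)"
      by (rule linear_independent_injective_image[OF linear_split_proj B(2) inj])
    have injB: "inj_on (?P x) B" using inj span_superset inj_on_subset by blast
    have "span (?P x ` B) \<subseteq> E x"
      by (intro span_minimal subspace_E) (auto simp: split_proj_in)
    moreover have "dim (span (?P x ` B)) = dim (E x)"
      using dim_span_eq_card_independent[OF ind] card_image[OF injB] B(4) dim by simp
    ultimately have "E x = span (?P x ` B)"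
      using subspace_dim_equal[OF subspace_span subspace_E] by (metis order_refl)
    moreover have "inj_on (?P x \<circ> b) {..<k}"
      using b injB by (intro comp_inj_on) (auto simp: bij_betw_def)
    ultimately show ?thesis using ind by (simp add: img comp_def)
  qed
  ultimately show "\<exists>U (r::nat) X. open U \<and> p \<in> U \<and> (\<forall>i<r. continuous_on U (X i)) \<and>
        (\<forall>x\<in>U. inj_on (\<lambda>i. X i x) {..<r} \<and> independent ((\<lambda>i. X i x) ` {..<r}) \<and>
               E x = span ((\<lambda>i. X i x) ` {..<r}))"
    by (intro exI[of _ U] exI[of _ k] exI[of _ "\<lambda>i x. ?P x (b i)"])
      (auto intro: continuous_on_subset[OF continuous_split_proj])
qed

end

text \<open>The frame is rewritten as a family of linear maps on one fixed space \<open>W\<close>,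
  spanned by as many standard basis vectors as the rank. Coefficients of frame vectors thereby range
  over compact subsets of a space independent of \<open>x\<close>.\<close>

lemma continuous_subbundle_frame:
  fixes E :: "'a::euclidean_space \<Rightarrow> 'a set"
  assumes "continuous_subbundle E"
  shows "\<exists>U (W :: 'a set) T. open U \<and> p \<in> U \<and> subspace W \<and> (\<forall>x. linear (T x)) \<and>
    (\<forall>v. continuous_on U (\<lambda>x. T x v)) \<and> (\<forall>x\<in>U. inj_on (T x) W \<and> E x = T x ` W)"
proof -
  from assms[unfolded continuous_subbundle_def, THEN spec, of p]
  obtain U and r :: nat and X where U: "open U" "p \<in> U" and X: "\<forall>i<r. continuous_on U (X i)"
    and fr': "\<forall>x\<in>U. inj_on (\<lambda>i. X i x) {..<r} \<and> independent ((\<lambda>i. X i x) ` {..<r}) \<and>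
               E x = span ((\<lambda>i. X i x) ` {..<r})"
    by (elim exE conjE)
  note fr = fr'[rule_format]
  have "r = card ((\<lambda>i. X i p) ` {..<r})" using fr[OF U(2)] by (simp add: card_image)
  also have "\<dots> \<le> DIM('a)" using independent_bound fr[OF U(2)] by blast
  finally have "card {..<r} \<le> card (Basis :: 'a set)" by simp
  then obtain b where b: "b ` {..<r} \<subseteq> (Basis :: 'a set)" "inj_on b {..<r}"
    using card_le_inj[of "{..<r}" "Basis :: 'a set"] by auto
  define T where "T = (\<lambda>x w. \<Sum>i<r. (w \<bullet> b i) *\<^sub>R X i x)"
  have lin: "linear (T x)" for x
    unfolding T_def
    by (intro linear_compose_sum ballI linearI) (auto simp: inner_left_distrib scaleR_left_distrib)
  have Tb: "T x (b j) = X j x" if "j < r" for x j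
  proof -
    have "(b j \<bullet> b i) *\<^sub>R X i x = (if i = j then X j x else 0)" if "i < r" for i
      using b \<open>j < r\<close> that by (subst inner_Basis) (auto simp: inj_on_eq_iff[OF b(2)])
    then have "T x (b j) = (\<Sum>i<r. if i = j then X j x else 0)"
      unfolding T_def by (intro sum.cong) auto
    then show ?thesis using that by simp
  qed
  have img: "(\<lambda>i. X i x) ` {..<r} = T x ` (b ` {..<r})" for x
    using Tb by (auto simp: image_image)
  have inj: "inj_on (T x) (span (b ` {..<r}))" if "x \<in> U" for x
  proof (rule linear_inj_on_span_independent_image[OF lin])
    show "independent (T x ` b ` {..<r})" using fr[OF that] unfolding img by blast
    show "inj_on (T x) (b ` {..<r})"
      using fr[OF that] Tb by (auto simp: inj_on_def)
  qed
  show ?thesis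
  proof (intro exI conjI allI ballI)
    show "open U" "p \<in> U" "subspace (span (b ` {..<r}))" "linear (T x)" for x
      by (simp_all add: U lin)
    show "continuous_on U (\<lambda>x. T x v)" for v
      unfolding T_def by (intro continuous_intros X[rule_format]) auto
    show "inj_on (T x) (span (b ` {..<r}))" if "x \<in> U" for x by (rule inj[OF that])
    show "E x = T x ` span (b ` {..<r})" if "x \<in> U" for x
      using fr[OF that] unfolding img linear_span_image[OF lin, symmetric] by blast
  qed
qed

lemma continuous_subbundle_subspace:
  fixes E :: "'a::euclidean_space \<Rightarrow> 'a set"
  assumes "continuous_subbundle E"
  shows "subspace (E x)"
proof -
  from continuous_subbundle_frame[OF assms, of x]
  obtain U and W :: "'a set" and T where U: "open U" "x \<in> U" and W: "subspace W"
    and lin': "\<forall>x. linear (T x)" and cont': "\<forall>v. continuous_on U (\<lambda>x. T x v)"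
    and T: "\<forall>x\<in>U. inj_on (T x) W \<and> E x = T x ` W"
    by (elim exE conjE)
  note lin = lin'[rule_format] and cont = cont'[rule_format]
  have inj: "inj_on (T x) W" and E: "E x = T x ` W" if "x \<in> U" for x using T that by auto
  show ?thesis unfolding E[OF U(2)] by (rule linear_subspace_image[OF lin W])
qed

text \<open>The rank is locally constant and the base is connected. The openness statement takes its
  \<open>k\<close> from here.\<close>

lemma continuous_subbundle_dim_const:
  fixes E :: "'a::euclidean_space \<Rightarrow> 'a set"
  assumes "continuous_subbundle E"
  obtains k where "\<And>x. dim (E x) = k"
proof -
  have "(\<lambda>x. dim (E x)) constant_on UNIV"
  proof (rule locally_constant_imp_constant[OF connected_UNIV])
    fix p
    from continuous_subbundle_frame[OF assms, of p]
  obtain U and W :: "'a set" and T where U: "open U" "p \<in> U" and W: "subspace W"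
    and lin': "\<forall>x. linear (T x)" and cont': "\<forall>v. continuous_on U (\<lambda>x. T x v)"
    and T: "\<forall>x\<in>U. inj_on (T x) W \<and> E x = T x ` W"
    by (elim exE conjE)
  note lin = lin'[rule_format] and cont = cont'[rule_format]
  have inj: "inj_on (T x) W" and E: "E x = T x ` W" if "x \<in> U" for x using T that by auto
    have span: "span W = W" using W by (simp add: span_eq_iff)
    have "dim (E x) = dim W" if "x \<in> U" for x
      unfolding E[OF that] using inj[OF that] by (intro dim_image_eq[OF lin]) (simp add: span)
    then show "\<exists>T. openin (top_of_set UNIV) T \<and> p \<in> T \<and> (\<forall>x\<in>T. dim (E x) = dim (E p))"
      using U by (intro exI[of _ U]) simp
  qed
  then show ?thesis using that unfolding constant_on_def by blast
qed

text \<open>Let \<open>v\<close> lie outside \<open>E p\<close>. Nearby vectors in nearby fibres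
  could only come from a bounded set of coefficients \<open>w\<close>, because the frame maps are
  uniformly bounded below near \<open>p\<close>. On that compact set \<open>T p w\<close> differs
  from \<open>v\<close>, which persists for nearby data.\<close>

lemma continuous_subbundle_closed_family:
  fixes E :: "'a::euclidean_space \<Rightarrow> 'a set"
  assumes "continuous_subbundle E"
  shows "closed_family E"
  unfolding closed_family_def
proof (intro conjI allI)
  show "subspace (E x)" for x by (rule continuous_subbundle_subspace[OF assms])
  have "open (- {(x, v). v \<in> E x})"
  proof (subst open_subopen, intro ballI)
    fix z assume "z \<in> - {(x, v). v \<in> E x}"
    then obtain p v where z: "z = (p, v)" and v: "v \<notin> E p" by (cases z) auto
    from continuous_subbundle_frame[OF assms, of p]
  obtain U and W :: "'a set" and T where U: "open U" "p \<in> U" and W: "subspace W"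
    and lin': "\<forall>x. linear (T x)" and cont': "\<forall>v. continuous_on U (\<lambda>x. T x v)"
    and T: "\<forall>x\<in>U. inj_on (T x) W \<and> E x = T x ` W"
    by (elim exE conjE)
  note lin = lin'[rule_format] and cont = cont'[rule_format]
  have inj: "inj_on (T x) W" and E: "E x = T x ` W" if "x \<in> U" for x using T that by auto
    have compW: "compact (cball 0 R \<inter> W)" "compact (sphere 0 R \<inter> W)" for R
      by (intro compact_Int_closed compact_cball compact_sphere closed_subspace W)+
    \<comment> \<open>The real coordinate is a strict lower bound for \<open>T x w\<close>; at
      \<open>(p, 0)\<close> the condition is injectivity of \<open>T p\<close> on
      \<open>W\<close>.\<close>
    define V1 where "V1 = {z \<in> (U \<times> UNIV) \<times> UNIV. norm (T (fst (fst z)) (snd z)) > snd (fst z)}"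
    have op: "open (((U \<times> UNIV) \<times> UNIV) \<inter> f -` {0<..})"
      if "continuous_on ((U \<times> UNIV) \<times> UNIV) f" for f :: "('a \<times> 'c::euclidean_space) \<times> 'a \<Rightarrow> real"
      using that U(1) by (intro continuous_open_preimage open_Times) auto
    have contT: "continuous_on ((U \<times> UNIV) \<times> UNIV) (\<lambda>z::('a \<times> 'c::euclidean_space) \<times> 'a. T (fst (fst z)) (snd z))"
      by (rule continuous_on_linear_family[OF lin cont]) (auto intro!: continuous_intros)
    have "V1 = ((U \<times> UNIV) \<times> UNIV) \<inter> (\<lambda>z. norm (T (fst (fst z)) (snd z)) - snd (fst z)) -` {0<..}"
      by (auto simp: V1_def)
    moreover have "open \<dots>" by (intro op continuous_on_diff continuous_on_norm contT continuous_intros)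
    ultimately have "open V1" by simp
    then have Z1: "open {z. \<forall>w\<in>sphere 0 1 \<inter> W. (z, w) \<in> V1}"
      by (intro open_compact_Ball compW)
    have "T p w \<noteq> 0" if "w \<in> W" "w \<noteq> 0" for w
      using inj[OF U(2)] linear_inj_on_iff_eq_0[OF lin W] that by blast
    then have "(p, 0) \<in> {z. \<forall>w\<in>sphere 0 1 \<inter> W. (z, w) \<in> V1}" using U(2)
      by (auto simp: V1_def) (metis norm_zero zero_neq_one)
    then obtain e where e: "e > 0" "ball (p, 0) e \<subseteq> {z. \<forall>w\<in>sphere 0 1 \<inter> W. (z, w) \<in> V1}"
      using Z1 open_contains_ball by blast
    have lower: "(e / 2) * norm w \<le> norm (T x w)" if "dist p x < e / 2" "w \<in> W" for x w
    proof (cases "w = 0")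
      case False
      have "dist (p, 0) (x, e / 2) \<le> dist p x + dist 0 (e / 2)"
        by (simp only: dist_Pair_Pair sqrt_sum_squares_le_sum zero_le_dist)
      then have "(x, e / 2) \<in> ball (p, 0) e" using that e(1) by (simp add: dist_real_def)
      then have *: "\<forall>w\<in>sphere 0 1 \<inter> W. ((x, e / 2), w) \<in> V1" using e(2) by blast
      have "(1 / norm w) *\<^sub>R w \<in> sphere 0 1 \<inter> W" using False that W by (simp add: subspace_scale)
      then have "((x, e / 2), (1 / norm w) *\<^sub>R w) \<in> V1" using * by blast
      then have "e / 2 < norm (T x ((1 / norm w) *\<^sub>R w))" by (simp add: V1_def)
      then show ?thesis using False by (simp add: linear_cmul[OF lin] field_simps)
    qed simp
    \<comment> \<open>A vector within distance \<open>1\<close> of \<open>v\<close> has norm at most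
      \<open>norm v + 1\<close>, so its coefficient has norm at most \<open>R\<close> by
      \<open>lower\<close>.\<close>
    define R where "R = (norm v + 1) / (e / 2)"
    define V2 where "V2 = {z \<in> (U \<times> UNIV) \<times> UNIV. norm (T (fst (fst z)) (snd z) - snd (fst z)) > 0}"
    have "V2 = ((U \<times> UNIV) \<times> UNIV) \<inter> (\<lambda>z. norm (T (fst (fst z)) (snd z) - snd (fst z))) -` {0<..}"
      by (auto simp: V2_def)
    moreover have "open \<dots>" by (intro op continuous_on_diff continuous_on_norm contT continuous_intros)
    ultimately have "open V2" by simp
    then have Z2: "open {z. \<forall>w\<in>cball 0 R \<inter> W. (z, w) \<in> V2}"
      by (intro open_compact_Ball compW)
    let ?N = "{z. \<forall>w\<in>cball 0 R \<inter> W. (z, w) \<in> V2} \<inter> ((U \<inter> ball p (e / 2)) \<times> ball v 1)"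
    have "open ?N" using Z2 U(1) by (intro open_Int open_Times) auto
    moreover have "(p, v) \<in> ?N" using U(2) e(1) v E[OF U(2)] by (auto simp: V2_def)
    moreover have "v' \<notin> E x" if N: "(x, v') \<in> ?N" for x v'
    proof
      assume "v' \<in> E x"
      then obtain w where w: "w \<in> W" "v' = T x w" using E N by auto
      have "norm v' \<le> norm v + dist v v'"
        using norm_triangle_ineq2[of v' v] by (simp add: dist_norm norm_minus_commute)
      then have "(e / 2) * norm w \<le> norm v + 1" using lower[of x w] w N by auto
      then have "w \<in> cball 0 R" using e(1) by (simp add: R_def field_simps)
      then have "((x, v'), w) \<in> V2" using N w by blast
      then show False using w by (simp add: V2_def)
    qed
    ultimately show "\<exists>N. open N \<and> z \<in> N \<and> N \<subseteq> - {(x, v). v \<in> E x}"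
      unfolding z by (intro exI[of _ ?N]) blast
  qed
  then show "closed {(x, v). v \<in> E x}" by (simp add: closed_def)
qed

lemma continuous_splitting_imp_splitting:
  assumes "continuous_splitting Es Eu"
  shows "splitting Es Eu"
  using assms unfolding continuous_splitting_def splitting_def
  by (simp add: continuous_subbundle_closed_family)


section \<open>Hyperbolic splittings from Lyapunov forms\<close>

lemma Diff1_has_derivative: "h \<in> Diff1 \<Longrightarrow> (h has_derivative frechet_derivative h (at x)) (at x)"
  by (simp add: Diff1_def frechet_derivative_works[symmetric])

lemma Diff1_linear: "h \<in> Diff1 \<Longrightarrow> linear (frechet_derivative h (at x))"
  using Diff1_has_derivative has_derivative_linear by blast

lemma Diff1_continuous_derivative:
  "h \<in> Diff1 \<Longrightarrow> continuous_on UNIV (\<lambda>x. frechet_derivative h (at x) v)"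
  by (simp add: Diff1_def)

lemma Diff1_continuous_on: "h \<in> Diff1 \<Longrightarrow> continuous_on UNIV h"
  using Diff1_has_derivative has_derivative_continuous
  by (metis continuous_at_imp_continuous_on)

lemma Diff1_bij: "h \<in> Diff1 \<Longrightarrow> bij h"
  by (simp add: Diff1_def)

lemma Diff1_inv: "h \<in> Diff1 \<Longrightarrow> inv h \<in> Diff1"
  by (simp add: Diff1_def bij_imp_bij_inv inv_inv_eq)

lemma Diff1_inv_apply: "h \<in> Diff1 \<Longrightarrow> inv h (h x) = x" "h \<in> Diff1 \<Longrightarrow> h (inv h x) = x"
  using Diff1_bij by (metis bij_inv_eq_iff)+

lemma Diff1_derivative_comp:
  assumes "h \<in> Diff1" "k \<in> Diff1"
  shows "frechet_derivative (h \<circ> k) (at x) v =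
    frechet_derivative h (at (k x)) (frechet_derivative k (at x) v)"
proof -
  have "(h \<circ> k has_derivative
      (frechet_derivative h (at (k x)) \<circ> frechet_derivative k (at x))) (at x)"
    by (intro diff_chain_at Diff1_has_derivative assms)
  from frechet_derivative_at[OF this, symmetric] show ?thesis by simp
qed

lemma Diff1_comp_Ck:
  assumes "h \<in> Diff1" "k \<in> Diff1"
  shows "Ck 1 (h \<circ> k)"
proof -
  have "Ck (Suc 0) (h \<circ> k)"
  proof (rule Ck_SucI)
    show "(h \<circ> k has_derivative
        (\<lambda>v. frechet_derivative h (at (k x)) (frechet_derivative k (at x) v))) (at x)" for x
      using diff_chain_at[OF Diff1_has_derivative[OF assms(2)] Diff1_has_derivative[OF assms(1)]]
      by (simp add: comp_def)
    have "continuous_on UNIV (\<lambda>x. frechet_derivative h (at (k x)) (frechet_derivative k (at x) v))" for v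
      by (rule continuous_on_linear_family[where U = UNIV, OF Diff1_linear[OF assms(1)]
            Diff1_continuous_derivative[OF assms(1)]])
        (simp_all add: Diff1_continuous_on Diff1_continuous_derivative assms)
    then show "Ck 0 (\<lambda>x. frechet_derivative h (at (k x)) (frechet_derivative k (at x) v))" for v
      by simp
  qed
  then show ?thesis by simp
qed

lemma Diff1_comp:
  assumes "h \<in> Diff1" "k \<in> Diff1"
  shows "h \<circ> k \<in> Diff1"
proof -
  have "inv (h \<circ> k) = inv k \<circ> inv h"
    by (intro o_inv_distrib Diff1_bij assms)
  then have "Ck 1 (inv (h \<circ> k))" using Diff1_comp_Ck[OF Diff1_inv[OF assms(2)] Diff1_inv[OF assms(1)]] by simp
  then show ?thesis
    using Diff1_comp_Ck[OF assms] bij_comp[OF Diff1_bij[OF assms(2)] Diff1_bij[OF assms(1)]]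
    by (simp add: Diff1_def)
qed

lemma Diff1_id: "id \<in> Diff1"
proof -
  have "Ck k (id :: 'a \<Rightarrow> 'a)" for k
    by (rule Ck_linear) (simp add: linear_id)
  then show ?thesis unfolding Diff1_def by (simp del: Ck.simps One_nat_def)
qed

lemma Diff1_funpow: "h \<in> Diff1 \<Longrightarrow> h ^^ m \<in> Diff1"
  by (induction m) (auto simp: Diff1_id Diff1_comp)

lemma Diff1_derivative_inverse:
  assumes "h \<in> Diff1"
  shows "frechet_derivative (inv h) (at (h x)) (frechet_derivative h (at x) v) = v"
    and "frechet_derivative h (at (inv h x)) (frechet_derivative (inv h) (at x) v) = v"
proof -
  have "inv h \<circ> h = id" "h \<circ> inv h = id"
    using Diff1_bij[OF assms] by (auto simp: bij_def surj_iff)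
  then show "frechet_derivative (inv h) (at (h x)) (frechet_derivative h (at x) v) = v"
    "frechet_derivative h (at (inv h x)) (frechet_derivative (inv h) (at x) v) = v"
    using Diff1_derivative_comp[OF Diff1_inv[OF assms] assms, of x v]
      Diff1_derivative_comp[OF assms Diff1_inv[OF assms], of x v] by simp_all
qed

text \<open>Splitting off the last step gives increments along an orbit; splitting off the first one
  gives the shift of base point behind invariance.\<close>

lemma Diff1_derivative_funpow_Suc:
  assumes "h \<in> Diff1"
  shows "frechet_derivative (h ^^ Suc m) (at x) v =
      frechet_derivative h (at ((h ^^ m) x)) (frechet_derivative (h ^^ m) (at x) v)"
    and "frechet_derivative (h ^^ Suc m) (at x) v =
      frechet_derivative (h ^^ m) (at (h x)) (frechet_derivative h (at x) v)"
proof -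
  show "frechet_derivative (h ^^ Suc m) (at x) v =
      frechet_derivative h (at ((h ^^ m) x)) (frechet_derivative (h ^^ m) (at x) v)"
    using Diff1_derivative_comp[OF assms Diff1_funpow[OF assms, of m]] by simp
  show "frechet_derivative (h ^^ Suc m) (at x) v =
      frechet_derivative (h ^^ m) (at (h x)) (frechet_derivative h (at x) v)"
    unfolding funpow_Suc_right using Diff1_derivative_comp[OF Diff1_funpow[OF assms, of m] assms] .
qed

lemma Diff1_derivative_funpow_inverse:
  assumes "h \<in> Diff1"
  shows "frechet_derivative (h ^^ m) (at x) (frechet_derivative (inv h ^^ m) (at ((h ^^ m) x)) w) = w"
proof -
  have "(inv h ^^ m) = inv (h ^^ m)" by (simp add: inv_fn Diff1_bij assms)
  then show ?thesis
    using Diff1_derivative_inverse(2)[OF Diff1_funpow[OF assms, of m], of "(h ^^ m) x" w]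
    by (simp add: Diff1_inv_apply Diff1_funpow assms)
qed

lemma Diff1_continuous_on_derivative:
  assumes "h \<in> Diff1" "continuous_on S a" "continuous_on S b"
  shows "continuous_on S (\<lambda>s. frechet_derivative h (at (a s)) (b s))"
  by (rule continuous_on_linear_family[where U = UNIV, OF Diff1_linear[OF assms(1)]
        Diff1_continuous_derivative[OF assms(1)] assms(2) _ assms(3)]) simp

text \<open>\<open>J_mono\<close> is symmetric in the two ends of a step, so the locale passes to
  \<open>inv h\<close> and \<open>- J\<close> with the same constants. The condition
  \<open>c < K\<close> puts the contraction factor \<open>1 - c / K\<close> strictly between
  \<open>0\<close> and \<open>1\<close>.\<close>

locale lyapunov_form =
  fixes h :: "'a::euclidean_space \<Rightarrow> 'a" and g :: "'a \<Rightarrow> 'a \<Rightarrow> 'a \<Rightarrow> real"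
    and J :: "'a \<Rightarrow> 'a \<Rightarrow> real" and c K :: real
  assumes h: "h \<in> Diff1" and g: "continuous_metric g"
    and J_cont: "continuous_on UNIV (\<lambda>z. J (fst z) (snd z))"
    and J_bound: "\<And>x v. \<bar>J x v\<bar> \<le> K * g x v v"
    and c: "0 < c" "c < K"
    and J_mono: "\<And>x v. c * (g x v v + g (h x) (frechet_derivative h (at x) v) (frechet_derivative h (at x) v))
      \<le> J (h x) (frechet_derivative h (at x) v) - J x v"
begin

definition orbit_g :: "nat \<Rightarrow> 'a \<Rightarrow> 'a \<Rightarrow> real" where
  "orbit_g m x v = g ((h ^^ m) x) (frechet_derivative (h ^^ m) (at x) v) (frechet_derivative (h ^^ m) (at x) v)"

definition orbit_J :: "nat \<Rightarrow> 'a \<Rightarrow> 'a \<Rightarrow> real" where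
  "orbit_J m x v = J ((h ^^ m) x) (frechet_derivative (h ^^ m) (at x) v)"

text \<open>Convergence makes this visibly an invariant subspace. The equivalent sign condition
  \<open>stable_iff\<close> is what makes it closed and amenable to compactness.\<close>

definition stable :: "'a \<Rightarrow> 'a set" where
  "stable x = {v. (\<lambda>m. orbit_g m x v) \<longlonglongrightarrow> 0}"

lemma orbit_g_nonneg: "orbit_g m x v \<ge> 0"
  by (simp add: orbit_g_def continuous_metric_nonneg[OF g])

lemma orbit_g_0: "orbit_g 0 x v = g x v v"
  by (simp add: orbit_g_def)

lemma orbit_J_0: "orbit_J 0 x v = J x v"
  by (simp add: orbit_J_def)

lemma orbit_g_Suc: "orbit_g (Suc m) x v = orbit_g m (h x) (frechet_derivative h (at x) v)"
  unfolding orbit_g_def Diff1_derivative_funpow_Suc(2)[OF h] by (simp only: funpow_Suc_right o_apply)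

lemma orbit_J_bound: "\<bar>orbit_J m x v\<bar> \<le> K * orbit_g m x v"
  by (simp add: orbit_g_def orbit_J_def J_bound)

lemma orbit_J_step: "c * (orbit_g m x v + orbit_g (Suc m) x v) \<le> orbit_J (Suc m) x v - orbit_J m x v"
  unfolding orbit_g_def orbit_J_def Diff1_derivative_funpow_Suc(1)[OF h]
  using J_mono[of "(h ^^ m) x" "frechet_derivative (h ^^ m) (at x) v"] by simp

lemma incseq_orbit_J: "incseq (\<lambda>m. orbit_J m x v)"
proof (rule incseq_SucI)
  fix m
  have "0 \<le> c * (orbit_g m x v + orbit_g (Suc m) x v)"
    using c(1) orbit_g_nonneg by simp
  then show "orbit_J m x v \<le> orbit_J (Suc m) x v" using orbit_J_step[of m x v] by linarith
qed

text \<open>The form increases along the orbit and tends to \<open>0\<close> together with the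
  squared length, so it approaches \<open>0\<close> from below.\<close>

lemma stable_imp_J_nonpos:
  assumes "v \<in> stable x"
  shows "orbit_J m x v \<le> 0"
proof (rule incseq_le[OF incseq_orbit_J])
  have "(\<lambda>m. K * orbit_g m x v) \<longlonglongrightarrow> K * 0"
    using assms unfolding stable_def by (intro tendsto_mult_left) simp
  then have "(\<lambda>m. K * orbit_g m x v) \<longlonglongrightarrow> 0" by simp
  then show "(\<lambda>m. orbit_J m x v) \<longlonglongrightarrow> 0"
    by (rule Lim_null_comparison[rotated]) (simp add: orbit_J_bound)
qed

text \<open>While the form stays nonpositive, \<open>- J\<close> shrinks by the factor \<open>1 - c / K\<close> in every step.\<close>

lemma orbit_g_decay:
  assumes "\<And>m. orbit_J m x v \<le> 0"
  shows "orbit_g m x v \<le> K / c * (1 - c / K) ^ m * g x v v"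
proof -
  have "K > 0" using c by simp
  have r: "0 < 1 - c / K" using c \<open>K > 0\<close> by simp
  have "- orbit_J m x v \<le> (1 - c / K) ^ m * (K * g x v v)" for m
  proof (induction m)
    case 0
    then show ?case using orbit_J_bound[of 0 x v] by (simp add: orbit_g_0)
  next
    case (Suc m)
    have "- orbit_J m x v \<le> K * orbit_g m x v" using orbit_J_bound[of m x v] by linarith
    then have "c / K * (- orbit_J m x v) \<le> c / K * (K * orbit_g m x v)"
      using c \<open>K > 0\<close> by (intro mult_left_mono) auto
    also have "\<dots> = c * orbit_g m x v" using \<open>K > 0\<close> by simp
    also have "\<dots> \<le> c * (orbit_g m x v + orbit_g (Suc m) x v)"
      using c orbit_g_nonneg by simp
    finally have "- orbit_J (Suc m) x v \<le> - orbit_J m x v - c / K * (- orbit_J m x v)"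
      using orbit_J_step[of m x v] by linarith
    also have "\<dots> = (1 - c / K) * (- orbit_J m x v)" by (simp add: algebra_simps)
    also have "\<dots> \<le> (1 - c / K) * ((1 - c / K) ^ m * (K * g x v v))"
      using Suc.IH r by (intro mult_left_mono) auto
    finally show ?case by (simp add: mult.assoc)
  qed
  \<comment> \<open>The form is still nonpositive one step later, so the increment, which dominates
    \<open>c * orbit_g m x v\<close>, is at most \<open>- orbit_J m x v\<close>.\<close>
  moreover have "c * orbit_g m x v \<le> - orbit_J m x v"
  proof -
    have "c * orbit_g m x v \<le> c * (orbit_g m x v + orbit_g (Suc m) x v)"
      using c orbit_g_nonneg by simp
    then show ?thesis using orbit_J_step[of m x v] assms[of "Suc m"] by linarith
  qed
  ultimately have "c * orbit_g m x v \<le> (1 - c / K) ^ m * (K * g x v v)" by (meson order_trans)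
  then show ?thesis using c(1) by (simp add: field_simps)
qed

lemma stable_iff: "v \<in> stable x \<longleftrightarrow> (\<forall>m. orbit_J m x v \<le> 0)"
proof
  assume J: "\<forall>m. orbit_J m x v \<le> 0"
  have "(\<lambda>m. (1 - c / K) ^ m) \<longlonglongrightarrow> 0"
    using c by (intro LIMSEQ_realpow_zero) auto
  then have "(\<lambda>m. K / c * (1 - c / K) ^ m * g x v v) \<longlonglongrightarrow> K / c * 0 * g x v v"
    by (intro tendsto_mult tendsto_const)
  then have lim: "(\<lambda>m. K / c * (1 - c / K) ^ m * g x v v) \<longlonglongrightarrow> 0" by simp
  have le: "norm (orbit_g m x v) \<le> K / c * (1 - c / K) ^ m * g x v v" for m
    using orbit_g_decay J orbit_g_nonneg[of m x v] by simp
  show "v \<in> stable x"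
    unfolding stable_def mem_Collect_eq
    by (rule Lim_null_comparison[OF always_eventually lim]) (intro allI le)
qed (simp add: stable_imp_J_nonpos)

text \<open>A strict version of nonpositivity. Applied to \<open>inv h\<close> and
  \<open>- J\<close> as well, it excludes a common nonzero vector of the stable and unstable
  spaces.\<close>

lemma stable_J_le: "v \<in> stable x \<Longrightarrow> J x v \<le> - c * g x v v"
proof -
  assume "v \<in> stable x"
  then have "orbit_J (Suc 0) x v \<le> 0" by (rule stable_imp_J_nonpos)
  moreover have "c * g x v v \<le> c * (orbit_g 0 x v + orbit_g (Suc 0) x v)"
    using c orbit_g_nonneg by (simp add: orbit_g_0)
  ultimately show ?thesis using orbit_J_step[of 0 x v] by (simp add: orbit_J_0)
qed

lemma linear_orbit: "linear (frechet_derivative (h ^^ m) (at x))"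
  by (rule Diff1_linear[OF Diff1_funpow[OF h]])

lemma subspace_stable: "subspace (stable x)"
proof (rule subspaceI)
  have bil: "bilinear (g y)" for y using g by (simp add: continuous_metric_def)
  show "0 \<in> stable x"
    by (simp add: stable_def orbit_g_def linear_0[OF linear_orbit] bilinear_lzero[OF bil])
  show "r *\<^sub>R v \<in> stable x" if "v \<in> stable x" for r v
  proof -
    have "(\<lambda>m. r\<^sup>2 * orbit_g m x v) \<longlonglongrightarrow> r\<^sup>2 * 0"
      using that unfolding stable_def by (intro tendsto_mult_left) simp
    then show ?thesis
      by (simp add: stable_def orbit_g_def linear_cmul[OF linear_orbit] bilinear_scaleR_diag[OF bil])
  qed
  show "v + w \<in> stable x" if "v \<in> stable x" "w \<in> stable x" for v w
  proof -
    \<comment> \<open>Equivalent to \<open>g y (a - b) (a - b) >= 0\<close>; it replaces the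
      triangle inequality without square roots.\<close>
    have par: "g y (a + b) (a + b) \<le> 2 * g y a a + 2 * g y b b" for y a b
      using continuous_metric_nonneg[OF g, of y "a - b"]
      by (simp add: bilinear_ladd[OF bil] bilinear_radd[OF bil] bilinear_lsub[OF bil] bilinear_rsub[OF bil])
    have "(\<lambda>m. 2 * orbit_g m x v + 2 * orbit_g m x w) \<longlonglongrightarrow> 2 * 0 + 2 * 0"
      using that unfolding stable_def by (intro tendsto_add tendsto_mult_left) simp_all
    then have lim: "(\<lambda>m. 2 * orbit_g m x v + 2 * orbit_g m x w) \<longlonglongrightarrow> 0" by simp
    have le: "norm (orbit_g m x (v + w)) \<le> 2 * orbit_g m x v + 2 * orbit_g m x w" for m
      using par orbit_g_nonneg[of m x "v + w"] by (simp add: orbit_g_def linear_add[OF linear_orbit])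
    show ?thesis
      unfolding stable_def mem_Collect_eq
      by (rule Lim_null_comparison[OF always_eventually lim]) (intro allI le)
  qed
qed

text \<open>Dropping the first term of a sequence does not change its limit, so \<open>v\<close> is
  stable if and only if its image is; bijectivity of the derivative does the rest.\<close>

lemma stable_image: "frechet_derivative h (at x) ` stable x = stable (h x)"
proof -
  have iff: "frechet_derivative h (at x) v \<in> stable (h x) \<longleftrightarrow> v \<in> stable x" for v
    using filterlim_sequentially_Suc[of "\<lambda>m. orbit_g m x v" "nhds 0"] by (simp add: stable_def orbit_g_Suc)
  have "w \<in> frechet_derivative h (at x) ` stable x" if "w \<in> stable (h x)" for w
  proof -
    define v where "v = frechet_derivative (inv h) (at (h x)) w"
    have "frechet_derivative h (at x) v = w"
      using Diff1_derivative_inverse(2)[OF h, of "h x" w] by (simp add: v_def Diff1_inv_apply h)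
    then show ?thesis using iff[of v] that by blast
  qed
  then show ?thesis using iff by blast
qed

lemma continuous_orbit_J: "continuous_on UNIV (\<lambda>z. orbit_J m (fst z) (snd z))"
proof -
  have "continuous_on UNIV (\<lambda>z::'a \<times> 'a. ((h ^^ m) (fst z), frechet_derivative (h ^^ m) (at (fst z)) (snd z)))"
    by (intro continuous_on_Pair Diff1_continuous_on_derivative[OF Diff1_funpow[OF h]]
        continuous_on_compose2[OF Diff1_continuous_on[OF Diff1_funpow[OF h]]] continuous_on_fst
        continuous_on_snd continuous_on_id subset_UNIV)
  from continuous_on_compose2[OF J_cont this] show ?thesis by (simp add: orbit_J_def)
qed

lemma closed_family_stable: "closed_family stable"
  unfolding closed_family_def
proof (intro conjI allI subspace_stable)
  have "{(x, v). v \<in> stable x} = (\<Inter>m. {z. orbit_J m (fst z) (snd z) \<le> 0})"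
    by (auto simp: stable_iff)
  also have "closed \<dots>"
    by (intro closed_INT ballI closed_Collect_le continuous_orbit_J continuous_on_const)
  finally show "closed {(x, v). v \<in> stable x}" .
qed

text \<open>The stable space meets every complement \<open>R\<close> trivially, so by compactness of the unit sphere of
  \<open>R\<close> already \<open>R\<close> contains no vector whose form stays nonpositive up to some finite time \<open>m\<close>. The pull
  back by \<open>h ^^ m\<close> of the given nonpositive space is then transversal to \<open>R\<close>.\<close>

lemma dim_stable_ge:
  assumes S: "\<And>y. subspace (S y)" "\<And>y. dim (S y) = k" "\<And>y v. v \<in> S y \<Longrightarrow> J y v \<le> 0"
  shows "k \<le> dim (stable x)"
proof -
  define R where "R = {w. \<forall>v\<in>stable x. orthogonal v w}"
  have R: "subspace R" unfolding R_def by (rule subspace_orthogonal_to_vectors)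
  have dimR: "dim R + dim (stable x) = DIM('a)"
    using dim_subspace_orthogonal_to_vectors[OF subspace_stable subspace_UNIV subset_UNIV, of x]
    by (simp add: R_def)
  \<comment> \<open>These compact sets are nested because the form increases with \<open>m\<close>.
    A common point would be a unit vector both stable and orthogonal to all stable vectors.\<close>
  define F where "F = (\<lambda>m. sphere 0 1 \<inter> R \<inter> {v. orbit_J m x v \<le> 0})"
  have "\<exists>m. F m = {}"
  proof (rule ccontr)
    assume ne: "\<nexists>m. F m = {}"
    have "compact (F m)" for m
    proof -
      have "continuous_on UNIV (\<lambda>v. orbit_J m x v)"
        using continuous_on_compose2[OF continuous_orbit_J[of m], of UNIV "\<lambda>v. (x, v)"]
        by (simp add: continuous_on_Pair)
      then show ?thesis
        unfolding F_def by (intro compact_Int_closed compact_sphere closed_subspace R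
            closed_Collect_le continuous_on_const)
    qed
    moreover have "F n \<subseteq> F m" if "m \<le> n" for m n
      using incseqD[OF incseq_orbit_J that] unfolding F_def by (blast intro: order_trans)
    ultimately have "\<Inter>(range F) \<noteq> {}" using ne by (intro compact_nest) auto
    then obtain v where v: "\<And>m. v \<in> F m" by blast
    then have "v \<in> stable x" "v \<in> R" "norm v = 1" by (auto simp: F_def stable_iff)
    then show False by (auto simp: R_def orthogonal_self)
  qed
  then obtain m where m: "F m = {}" ..
  let ?A = "frechet_derivative (inv h ^^ m) (at ((h ^^ m) x))"
  have A: "linear ?A" by (rule Diff1_linear[OF Diff1_funpow[OF Diff1_inv[OF h]]])
  have DA: "frechet_derivative (h ^^ m) (at x) (?A w) = w" for w
    by (rule Diff1_derivative_funpow_inverse[OF h])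
  define T where "T = ?A ` S ((h ^^ m) x)"
  have T: "subspace T" unfolding T_def by (rule linear_subspace_image[OF A S(1)])
  have "inj ?A" using DA by (metis injI)
  then have "dim T = k"
    unfolding T_def using dim_image_eq[OF A] S(2) by (metis inj_on_subset subset_UNIV)
  have "T \<inter> R \<subseteq> {0}"
  proof
    fix v assume v: "v \<in> T \<inter> R"
    show "v \<in> {0}"
    proof (rule ccontr)
      assume "v \<notin> {0}"
      let ?v = "(1 / norm v) *\<^sub>R v"
      have "?v \<in> T" "?v \<in> R" using v T R by (auto simp: subspace_scale)
      then have "frechet_derivative (h ^^ m) (at x) ?v \<in> S ((h ^^ m) x)"
        using DA unfolding T_def by auto
      then have "orbit_J m x ?v \<le> 0" unfolding orbit_J_def by (rule S(3))
      then have "?v \<in> F m" using \<open>v \<notin> {0}\<close> \<open>?v \<in> R\<close> by (simp add: F_def)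
      then show False using m by blast
    qed
  qed
  then have "dim (T \<inter> R) = 0" by simp
  moreover have "dim {u + v |u v. u \<in> T \<and> v \<in> R} \<le> DIM('a)" by (rule dim_subset_UNIV)
  \<comment> \<open>Since \<open>R\<close> has dimension \<open>DIM('a) - dim (stable x)\<close>,
    this is the asserted bound.\<close>
  ultimately have "k + dim R \<le> DIM('a)"
    using dim_sums_Int[OF T R] \<open>dim T = k\<close> by linarith
  then show ?thesis using dimR by simp
qed

lemma stable_rnorm_decay:
  assumes "v \<in> stable x"
  shows "rnorm g ((h ^^ m) x) (frechet_derivative (h ^^ m) (at x) v)
    \<le> sqrt (K / c) * sqrt (1 - c / K) ^ m * rnorm g x v"
proof -
  have "orbit_g m x v \<le> K / c * (1 - c / K) ^ m * g x v v"
    using assms by (intro orbit_g_decay) (simp add: stable_iff)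
  from real_sqrt_le_mono[OF this] show ?thesis
    by (simp only: rnorm_def orbit_g_def real_sqrt_mult real_sqrt_power)
qed

text \<open>The increase along a step of \<open>h\<close> that ends at \<open>x\<close>, read
  backwards, is the increase of \<open>- J\<close> along the step of \<open>inv h\<close> that
  starts at \<open>x\<close>.\<close>

lemma lyapunov_form_inv: "lyapunov_form (inv h) g (\<lambda>x v. - J x v) c K"
proof
  show "inv h \<in> Diff1" by (rule Diff1_inv[OF h])
  show "continuous_on UNIV (\<lambda>z. - J (fst z) (snd z))" by (intro continuous_on_minus J_cont)
  show "\<bar>- J x v\<bar> \<le> K * g x v v" for x v using J_bound by simp
  let ?D = "\<lambda>x. frechet_derivative (inv h) (at x)"
  show "c * (g x v v + g (inv h x) (?D x v) (?D x v)) \<le> - J (inv h x) (?D x v) - - J x v" for x v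
    using J_mono[of "inv h x" "?D x v"]
    by (simp add: Diff1_inv_apply Diff1_derivative_inverse h add.commute)
qed (use g c in auto)

text \<open>The test spaces \<open>S\<close> and \<open>U\<close> bound the two dimensions from
  below by \<open>k\<close> and \<open>DIM('a) - k\<close>. The trivial intersection bounds their
  sum from above by \<open>DIM('a)\<close>, so both bounds are equalities and the spaces are
  complementary. Square roots in the constants come from passing from squared lengths to
  norms.\<close>

theorem anosov_with_lyapunov_form:
  assumes S: "\<And>y. subspace (S y)" "\<And>y. dim (S y) = k" "\<And>y v. v \<in> S y \<Longrightarrow> J y v \<le> 0"
    and U: "\<And>y. subspace (U y)" "\<And>y. dim (U y) = DIM('a) - k" "\<And>y v. v \<in> U y \<Longrightarrow> J y v \<ge> 0"
    and k: "k \<le> DIM('a)"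
  obtains Es Eu where "anosov_with g h Es Eu (sqrt (K / c)) (sqrt (1 - c / K))"
    "\<And>x. dim (Es x) = k" "\<And>x. dim (Eu x) = DIM('a) - k"
proof -
  interpret I: lyapunov_form "inv h" g "\<lambda>x v. - J x v" c K by (rule lyapunov_form_inv)
  have inter: "stable x \<inter> I.stable x = {0}" for x
  proof -
    have "v = 0" if "v \<in> stable x" "v \<in> I.stable x" for v
    proof (rule ccontr)
      assume "v \<noteq> 0"
      then have "g x v v > 0" using g by (simp add: continuous_metric_def)
      then have "c * g x v v > 0" using c by simp
      then show False using stable_J_le[OF that(1)] I.stable_J_le[OF that(2)] by simp
    qed
    then show ?thesis using subspace_0 subspace_stable I.subspace_stable by blast
  qed
  let ?sum = "\<lambda>x. {u + v |u v. u \<in> stable x \<and> v \<in> I.stable x}"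
  have dsum: "dim (?sum x) = dim (stable x) + dim (I.stable x)" for x
    using dim_sums_Int[OF subspace_stable I.subspace_stable, of x x] inter[of x] by simp
  have ds: "k \<le> dim (stable x)" for x by (rule dim_stable_ge[OF S])
  have du: "DIM('a) - k \<le> dim (I.stable x)" for x
    by (rule I.dim_stable_ge[where S = U]) (use U in auto)
  have dle: "dim (?sum x) \<le> DIM('a)" for x by (rule dim_subset_UNIV)
  have dims: "dim (stable x) = k" "dim (I.stable x) = DIM('a) - k" "dim (?sum x) = DIM('a)" for x
    using ds[of x] du[of x] k dle[of x] unfolding dsum by linarith+
  have sum: "?sum x = UNIV" for x
  proof -
    have "span (?sum x) = UNIV" using dims(3)[of x] by (simp only: dim_eq_full)
    moreover have "span (?sum x) = ?sum x"
      using subspace_sums[OF subspace_stable I.subspace_stable, of x x] by (simp only: span_eq_iff)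
    ultimately show ?thesis by (rule trans[OF sym, rotated])
  qed
  have split: "splitting stable I.stable"
  proof
    show "\<exists>u\<in>stable x. \<exists>v\<in>I.stable x. w = u + v" for x w using sum[of x] by blast
  qed (use closed_family_stable I.closed_family_stable inter in auto)
  have "continuous_splitting stable I.stable"
    unfolding continuous_splitting_def
    by (intro conjI allI splitting.continuous_subbundle_E[OF split dims(1)]
      splitting.continuous_subbundle_E[OF splitting.splitting_swap[OF split] dims(2)]
      splitting.inter[OF split] splitting.sum_ex[OF split])
  moreover have "frechet_derivative h (at x) ` I.stable x = I.stable (h x)" for x
  proof -
    have "frechet_derivative h (at x) ` (frechet_derivative (inv h) (at (h x)) ` I.stable (h x)) = I.stable (h x)"
      using Diff1_derivative_inverse(2)[OF h, of "h x"] by (simp add: image_image Diff1_inv_apply h)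
    then show ?thesis using I.stable_image[of "h x"] by (simp add: Diff1_inv_apply h)
  qed
  moreover have "K > 0" using c by linarith
  ultimately have "anosov_with g h stable I.stable (sqrt (K / c)) (sqrt (1 - c / K))"
    unfolding anosov_with_def using stable_image stable_rnorm_decay I.stable_rnorm_decay c
    by simp
  then show ?thesis using dims that by blast
qed

end


section \<open>Openness in the Whitney topology\<close>

text \<open>\<open>P\<close> and \<open>v - P v\<close> are the stable and unstable components of \<open>v\<close>. The form is the difference
  of finite Lyapunov sums along \<open>M\<close> forward and backward iterates, with \<open>M\<close> so large that
  \<open>C\<^sup>2 \<mu>\<^bsup>2M\<^esup> \<le> 1/2\<close>: a shift of the orbit changes such a sum only by its end terms.\<close>

lemma anosov_lyapunov_form:
  fixes f :: "'a::euclidean_space \<Rightarrow> 'a"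
  assumes f: "f \<in> Diff1" and g: "continuous_metric g" and A: "anosov_with g f Es Eu C \<mu>"
  obtains G J c K where "continuous_metric G" "\<And>x v. g x v v \<le> 2 * G x v v" "0 < c"
    "continuous_on UNIV (\<lambda>z. J (fst z) (snd z))" "\<And>x v. \<bar>J x v\<bar> \<le> K * G x v v"
    "\<And>x v r. J x (r *\<^sub>R v) = r\<^sup>2 * J x v"
    "\<And>x v. c * (G x v v + G (f x) (frechet_derivative f (at x) v) (frechet_derivative f (at x) v))
      \<le> J (f x) (frechet_derivative f (at x) v) - J x v"
    "\<And>x v. v \<in> Es x \<Longrightarrow> J x v \<le> 0" "\<And>x v. v \<in> Eu x \<Longrightarrow> J x v \<ge> 0"
proof -
  interpret splitting Es Eu
    using A by (auto simp: anosov_with_def intro: continuous_splitting_imp_splitting)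
  have bil: "bilinear (g x)" for x using g by (simp add: continuous_metric_def)
  have gnn: "g x v v \<ge> 0" for x v by (rule continuous_metric_nonneg[OF g])
  have fi: "inv f \<in> Diff1" by (rule Diff1_inv[OF f])
  let ?D = "\<lambda>x. frechet_derivative f (at x)"
  let ?Dm = "\<lambda>m x. frechet_derivative (f ^^ m) (at x)"
  let ?Di = "\<lambda>m x. frechet_derivative (inv f ^^ m) (at x)"
  have inv_s: "?D x ` Es x = Es (f x)" and inv_u: "?D x ` Eu x = Eu (f x)" for x
    using A by (auto simp: anosov_with_def)
  have C: "C \<ge> 1" and \<mu>: "0 < \<mu>" "\<mu> < 1" using A by (auto simp: anosov_with_def)
  have sq: "a \<le> (C * \<mu> ^ m)\<^sup>2 * b" if "sqrt a \<le> C * \<mu> ^ m * sqrt b" "a \<ge> 0" "b \<ge> 0" for a b m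
  proof -
    have "(sqrt a)\<^sup>2 \<le> (C * \<mu> ^ m * sqrt b)\<^sup>2" using that by (intro power_mono) auto
    then show ?thesis using that by (simp add: power_mult_distrib)
  qed
  have dec_s: "g ((f ^^ m) x) (?Dm m x w) (?Dm m x w) \<le> (C * \<mu> ^ m)\<^sup>2 * g x w w" if "w \<in> Es x" for m x w
    using A that by (intro sq gnn) (auto simp: anosov_with_def rnorm_def)
  have dec_u: "g ((inv f ^^ m) x) (?Di m x w) (?Di m x w) \<le> (C * \<mu> ^ m)\<^sup>2 * g x w w" if "w \<in> Eu x" for m x w
    using A that by (intro sq gnn) (auto simp: anosov_with_def rnorm_def)
  have C\<mu>: "(C * \<mu> ^ m)\<^sup>2 \<le> C\<^sup>2" for m
  proof -
    have "C * \<mu> ^ m \<le> C * 1" using C \<mu> by (intro mult_left_mono power_le_one) auto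
    then show ?thesis using C \<mu> by (intro power_mono) auto
  qed
  have "(\<lambda>m. (C * \<mu> ^ m)\<^sup>2) \<longlonglongrightarrow> (C * 0)\<^sup>2"
    using \<mu> by (intro tendsto_power tendsto_mult tendsto_const LIMSEQ_realpow_zero) auto
  then have "\<forall>\<^sub>F m in sequentially. (C * \<mu> ^ m)\<^sup>2 < 1 / 2"
    by (rule order_tendstoD) simp
  then obtain M where M: "(C * \<mu> ^ M)\<^sup>2 < 1 / 2" by (auto simp: eventually_sequentially)

  define P where "P = split_proj Es Eu"
  define Q where "Q = (\<lambda>x v. v - P x v)"
  have Ps: "P x v \<in> Es x" and Qu: "Q x v \<in> Eu x" for x v
    by (auto simp: P_def Q_def split_proj_in split_proj_compl)
  have linP: "linear (P x)" and linQ: "linear (Q x)" for x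
    unfolding Q_def by (auto simp: P_def linear_split_proj intro!: linear_compose_sub linear_ident)
  have contP: "continuous_on UNIV (\<lambda>x. P x v)" and contQ: "continuous_on UNIV (\<lambda>x. Q x v)" for v
    unfolding Q_def P_def by (intro continuous_on_diff continuous_on_const continuous_split_proj)+
  have PD: "P (f x) (?D x v) = ?D x (P x v)" and QD: "Q (f x) (?D x v) = ?D x (Q x v)" for x v
  proof -
    have "?D x v - ?D x (P x v) = ?D x (Q x v)"
      by (simp add: Q_def linear_diff[OF Diff1_linear[OF f]])
    moreover have "?D x (P x v) \<in> Es (f x)" "?D x (Q x v) \<in> Eu (f x)"
      using Ps Qu inv_s inv_u by blast+
    ultimately show "P (f x) (?D x v) = ?D x (P x v)"
      unfolding P_def by (intro split_proj_eqI) auto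
    then show "Q (f x) (?D x v) = ?D x (Q x v)"
      by (simp add: Q_def linear_diff[OF Diff1_linear[OF f]])
  qed

  \<comment> \<open>The sum of the squared lengths of the two components, so \<open>P\<close> and
    \<open>Q\<close> have norm at most \<open>1\<close> in \<open>G\<close> whatever the angle in
    \<open>g\<close>.\<close>
  define G where "G = (\<lambda>x u v. g x (P x u) (P x v) + g x (Q x u) (Q x v))"
  have G: "continuous_metric G"
    unfolding continuous_metric_def
  proof (intro conjI allI impI)
    show "bilinear (G x)" for x
      unfolding bilinear_def G_def
      by (intro conjI allI linearI)
        (simp_all add: linear_add[OF linP] linear_add[OF linQ] linear_cmul[OF linP] linear_cmul[OF linQ]
          bilinear_ladd[OF bil] bilinear_radd[OF bil] bilinear_lmul[OF bil] bilinear_rmul[OF bil] algebra_simps)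
    have "g x a b = g x b a" for x a b using g unfolding continuous_metric_def by blast
    then show "G x u v = G x v u" for x u v unfolding G_def by metis
    show "0 < G x v v" if "v \<noteq> 0" for x v
    proof -
      have "P x v \<noteq> 0 \<or> Q x v \<noteq> 0" using that by (auto simp: Q_def)
      then show ?thesis
        unfolding G_def using g gnn[of x "P x v"] gnn[of x "Q x v"]
        by (auto simp: continuous_metric_def intro: add_pos_nonneg add_nonneg_pos)
    qed
    show "continuous_on UNIV (\<lambda>x. G x u v)" for u v
      unfolding G_def by (intro continuous_on_add continuous_on_metric[OF g] continuous_on_id contP contQ)
  qed
  have gG: "g x v v \<le> 2 * G x v v" for x v
  proof -
    have "v = P x v + Q x v" by (simp add: Q_def)
    moreover have "g x (a + b) (a + b) \<le> 2 * g x a a + 2 * g x b b" for a b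
      using gnn[of x "a - b"]
      by (simp add: bilinear_ladd[OF bil] bilinear_radd[OF bil] bilinear_lsub[OF bil] bilinear_rsub[OF bil])
    ultimately show ?thesis unfolding G_def by (metis distrib_left)
  qed

  \<comment> \<open>Squared lengths of the stable component after \<open>m\<close> forward steps
    and, in \<open>u\<close>, of the unstable component after \<open>m\<close> backward steps. Both
    decay in \<open>m\<close>.\<close>
  define s where "s = (\<lambda>m x v. g ((f ^^ m) x) (?Dm m x (P x v)) (?Dm m x (P x v)))"
  define u where "u = (\<lambda>m x v. g ((inv f ^^ m) x) (?Di m x (Q x v)) (?Di m x (Q x v)))"
  define J where "J = (\<lambda>x v. (\<Sum>m<M. u m x v) - (\<Sum>m<M. s m x v))"
  have s_nn: "s m x v \<ge> 0" and u_nn: "u m x v \<ge> 0" for m x v by (simp_all add: s_def u_def gnn)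
  have s_0: "s 0 x v = g x (P x v) (P x v)" and u_0: "u 0 x v = g x (Q x v) (Q x v)" for x v
    by (simp_all add: s_def u_def)
  have s_le: "s m x v \<le> (C * \<mu> ^ m)\<^sup>2 * s 0 x v" and u_le: "u m x v \<le> (C * \<mu> ^ m)\<^sup>2 * u 0 x v" for m x v
    unfolding s_0 u_0 by (simp_all only: s_def u_def dec_s[OF Ps] dec_u[OF Qu])
  have s_Suc: "s m (f x) (?D x v) = s (Suc m) x v" for m x v
    unfolding s_def PD Diff1_derivative_funpow_Suc(2)[OF f] by (simp only: funpow_Suc_right o_apply)
  have u_Suc: "u (Suc m) (f x) (?D x v) = u m x v" for m x v
    unfolding u_def QD Diff1_derivative_funpow_Suc(2)[OF fi] Diff1_derivative_inverse(1)[OF f]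
    by (simp only: funpow_Suc_right o_apply Diff1_inv_apply[OF f])
  have tele: "(\<Sum>m<M. a (Suc m)) = (\<Sum>m<M. a m) + a M - a 0" for a :: "nat \<Rightarrow> real"
    by (induction M) auto
  \<comment> \<open>The choice of \<open>M\<close> enters here: the last term of each sum loses at
    least half of the initial one.\<close>
  have half: "s M x v \<le> s 0 x v / 2" "u M x v \<le> u 0 x v / 2" for x v
    using s_le[of M x v] u_le[of M x v] mult_right_mono[OF less_imp_le[OF M] s_nn[of 0 x v]]
      mult_right_mono[OF less_imp_le[OF M] u_nn[of 0 x v]] by linarith+
  \<comment> \<open>The shift changes \<open>J\<close> by exactly \<open>s 0 - s M\<close> at
    \<open>x\<close> plus \<open>u 0 - u M\<close> at \<open>f x\<close>.\<close>
  have J_step: "(s 0 x v + u 0 (f x) (?D x v)) / 2 \<le> J (f x) (?D x v) - J x v" for x v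
  proof -
    have "(\<Sum>m<M. s m (f x) (?D x v)) = (\<Sum>m<M. s m x v) + s M x v - s 0 x v"
      unfolding s_Suc by (rule tele)
    moreover have "(\<Sum>m<M. u m x v) =
        (\<Sum>m<M. u m (f x) (?D x v)) + u M (f x) (?D x v) - u 0 (f x) (?D x v)"
      using tele[of "\<lambda>m. u m (f x) (?D x v)"] unfolding u_Suc .
    ultimately show ?thesis
      using half(1)[of x v] half(2)[of "f x" "?D x v"] by (simp add: J_def)
  qed
  have G_eq: "G x v v = s 0 x v + u 0 x v" for x v by (simp add: G_def s_0 u_0)
  \<comment> \<open>\<open>J_step\<close> controls the stable part at \<open>x\<close> and the
    unstable part at \<open>f x\<close> only. One step of the decay estimates, at the cost of the
    factor \<open>1 + C^2\<close>, bounds the two remaining parts.\<close>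
  have lower: "1 / (2 * (1 + C\<^sup>2)) * (G x v v + G (f x) (?D x v) (?D x v)) \<le> J (f x) (?D x v) - J x v" for x v
  proof -
    have "s 0 (f x) (?D x v) \<le> C\<^sup>2 * s 0 x v"
      using s_le[of 1 x v] mult_right_mono[OF C\<mu>[of 1] s_nn[of 0 x v]] s_Suc[of 0 x v] by simp
    moreover have "u 0 x v \<le> C\<^sup>2 * u 0 (f x) (?D x v)"
      using u_le[of 1 "f x" "?D x v"] mult_right_mono[OF C\<mu>[of 1] u_nn[of 0 "f x" "?D x v"]] u_Suc[of 0 x v] by simp
    ultimately have "G x v v + G (f x) (?D x v) (?D x v) \<le> (1 + C\<^sup>2) * (s 0 x v + u 0 (f x) (?D x v))"
      by (simp add: G_eq algebra_simps)
    also have "\<dots> \<le> (1 + C\<^sup>2) * (2 * (J (f x) (?D x v) - J x v))"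
      using J_step[of x v] by (intro mult_left_mono) auto
    finally have "G x v v + G (f x) (?D x v) (?D x v) \<le> 2 * (1 + C\<^sup>2) * (J (f x) (?D x v) - J x v)"
      by (simp add: algebra_simps)
    moreover have "2 * (1 + C\<^sup>2) > 0" by (simp add: add_pos_nonneg)
    ultimately show ?thesis by (simp add: pos_divide_le_eq mult.commute)
  qed
  have bound: "\<bar>J x v\<bar> \<le> (real M * C\<^sup>2) * G x v v" for x v
  proof -
    have "(\<Sum>m<M. s m x v) \<le> (\<Sum>m<M. C\<^sup>2 * s 0 x v)" "(\<Sum>m<M. u m x v) \<le> (\<Sum>m<M. C\<^sup>2 * u 0 x v)"
      using s_le u_le mult_right_mono[OF C\<mu> s_nn] mult_right_mono[OF C\<mu> u_nn]
      by (intro sum_mono; meson order_trans)+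
    moreover have "(\<Sum>m<M. s m x v) \<ge> 0" "(\<Sum>m<M. u m x v) \<ge> 0"
      by (simp_all add: sum_nonneg s_nn u_nn)
    moreover have "0 \<le> real M * C\<^sup>2 * s 0 x v" "0 \<le> real M * C\<^sup>2 * u 0 x v"
      by (simp_all add: s_nn u_nn)
    ultimately show ?thesis unfolding J_def G_eq by (simp add: algebra_simps abs_le_iff)
  qed
  have contJ: "continuous_on UNIV (\<lambda>z. J (fst z) (snd z))"
  proof -
    have T: "continuous_on UNIV (\<lambda>z::'a \<times> 'a. T (fst z) (snd z))"
      if "\<And>x. linear (T x)" "\<And>v. continuous_on UNIV (\<lambda>x. T x v)" for T :: "'a \<Rightarrow> 'a \<Rightarrow> 'a"
      by (rule continuous_on_linear_family[where U = UNIV, OF that])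
        (auto intro: continuous_on_fst continuous_on_snd continuous_on_id)
    have cterm: "continuous_on UNIV (\<lambda>z::'a \<times> 'a. g ((k ^^ m) (fst z))
        (frechet_derivative (k ^^ m) (at (fst z)) (T (fst z) (snd z)))
        (frechet_derivative (k ^^ m) (at (fst z)) (T (fst z) (snd z))))"
      if k: "k \<in> Diff1" and T: "continuous_on UNIV (\<lambda>z::'a \<times> 'a. T (fst z) (snd z))" for k m T
    proof -
      have 1: "continuous_on UNIV (\<lambda>z::'a \<times> 'a. (k ^^ m) (fst z))"
        by (rule continuous_on_compose2[OF Diff1_continuous_on[OF Diff1_funpow[OF k]]])
          (auto intro: continuous_on_fst continuous_on_id)
      have 2: "continuous_on UNIV (\<lambda>z::'a \<times> 'a. frechet_derivative (k ^^ m) (at (fst z)) (T (fst z) (snd z)))"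
        by (rule Diff1_continuous_on_derivative[OF Diff1_funpow[OF k] _ T])
          (auto intro: continuous_on_fst continuous_on_id)
      show ?thesis by (rule continuous_on_metric[OF g 1 2 2])
    qed
    show ?thesis
      unfolding J_def s_def u_def
      by (intro continuous_on_diff continuous_on_sum cterm[OF f T[OF linP contP]] cterm[OF fi T[OF linQ contQ]])
  qed
  have homJ: "J x (r *\<^sub>R v) = r\<^sup>2 * J x v" for x r v
  proof -
    have "s m x (r *\<^sub>R v) = r\<^sup>2 * s m x v" "u m x (r *\<^sub>R v) = r\<^sup>2 * u m x v" for m
      unfolding s_def u_def
      by (simp_all add: linear_cmul[OF linP] linear_cmul[OF linQ] bilinear_scaleR_diag[OF bil]
          linear_cmul[OF Diff1_linear[OF Diff1_funpow[OF f]]] linear_cmul[OF Diff1_linear[OF Diff1_funpow[OF fi]]])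
    then show ?thesis by (simp add: J_def sum_distrib_left right_diff_distrib)
  qed
  have Js: "J x v \<le> 0" if "v \<in> Es x" for x v
  proof -
    have "Q x v = 0" using split_proj_E[OF that] by (simp add: Q_def P_def)
    then have "u m x v = 0" for m
      by (simp add: u_def linear_0[OF Diff1_linear[OF Diff1_funpow[OF fi]]] bilinear_lzero[OF bil])
    then show ?thesis by (simp add: J_def sum_nonneg s_nn)
  qed
  have Ju: "J x v \<ge> 0" if "v \<in> Eu x" for x v
  proof -
    have "P x v = 0" using split_proj_F[OF that] by (simp add: P_def)
    then have "s m x v = 0" for m
      by (simp add: s_def linear_0[OF Diff1_linear[OF Diff1_funpow[OF f]]] bilinear_lzero[OF bil])
    then show ?thesis by (simp add: J_def sum_nonneg u_nn)
  qed
  have "1 / (2 * (1 + C\<^sup>2)) > 0" by (simp add: add_pos_nonneg)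
  from that[OF G gG this contJ bound homJ lower Js Ju] show ?thesis .
qed

text \<open>Derivatives as points of the normed space of bounded operators: this turns
  \<open>C1_gap\<close> into a sum of two distances, with continuity and the triangle inequality at
  hand.\<close>

definition blinfun_derivative :: "('a::euclidean_space \<Rightarrow> 'a) \<Rightarrow> 'a \<Rightarrow> 'a \<Rightarrow>\<^sub>L 'a" where
  "blinfun_derivative h x = Blinfun (frechet_derivative h (at x))"

lemma blinfun_derivative_apply:
  "h \<in> Diff1 \<Longrightarrow> blinfun_apply (blinfun_derivative h x) v = frechet_derivative h (at x) v"
  unfolding blinfun_derivative_def
  by (simp add: bounded_linear_Blinfun_apply has_derivative_bounded_linear[OF Diff1_has_derivative])

lemma continuous_blinfun_derivative:
  "h \<in> Diff1 \<Longrightarrow> continuous_on UNIV (blinfun_derivative h)"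
  by (rule continuous_on_blinfun_componentwise)
    (simp add: blinfun_derivative_apply Diff1_continuous_derivative)

lemma C1_gap_eq:
  assumes "h \<in> Diff1" "f \<in> Diff1"
  shows "C1_gap h f x = dist (h x) (f x) + dist (blinfun_derivative h x) (blinfun_derivative f x)"
proof -
  have "blinfun_apply (blinfun_derivative h x - blinfun_derivative f x) =
      (\<lambda>v. frechet_derivative h (at x) v - frechet_derivative f (at x) v)"
    by (rule ext) (simp add: blinfun.diff_left blinfun_derivative_apply assms)
  then show ?thesis by (simp only: C1_gap_def dist_norm norm_blinfun.rep_eq)
qed

text \<open>Around a member \<open>h\<close> the remaining sizes, \<open>\<epsilon>p\<close> and
  \<open>\<epsilon>m\<close> minus the gaps already used, are positive and continuous; the triangle
  inequality gives the inclusion.\<close>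

lemma whitney_open_nbhd:
  assumes f: "f \<in> Diff1" and "continuous_on UNIV \<epsilon>p" "continuous_on UNIV \<epsilon>m"
  shows "whitney_open (whitney_nbhd f \<epsilon>p \<epsilon>m)"
  unfolding whitney_open_def
proof (intro conjI ballI)
  show "whitney_nbhd f \<epsilon>p \<epsilon>m \<subseteq> Diff1" by (auto simp: whitney_nbhd_def)
  fix h assume h: "h \<in> whitney_nbhd f \<epsilon>p \<epsilon>m"
  then have hD: "h \<in> Diff1" by (simp add: whitney_nbhd_def)
  have cont: "continuous_on UNIV (C1_gap h k)" if "h \<in> Diff1" "k \<in> Diff1" for h k :: "'a \<Rightarrow> 'a"
  proof -
    have "continuous_on UNIV (\<lambda>x. dist (h x) (k x) + dist (blinfun_derivative h x) (blinfun_derivative k x))"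
      by (intro continuous_on_add continuous_on_dist Diff1_continuous_on continuous_blinfun_derivative that)
    then show ?thesis by (simp add: C1_gap_eq[OF that, abs_def])
  qed
  have tri: "C1_gap k f x \<le> C1_gap k h x + C1_gap h f x"
    if "k \<in> Diff1" "h \<in> Diff1" "f \<in> Diff1" for k h f :: "'a \<Rightarrow> 'a" and x
    using dist_triangle[of "k x" "f x" "h x"]
      dist_triangle[of "blinfun_derivative k x" "blinfun_derivative f x" "blinfun_derivative h x"]
    by (simp add: C1_gap_eq that)
  let ?p = "\<lambda>x. \<epsilon>p x - C1_gap h f x" and ?m = "\<lambda>x. \<epsilon>m x - C1_gap (inv h) (inv f) x"
  have "continuous_on UNIV ?p" "continuous_on UNIV ?m"
    by (intro continuous_on_diff assms cont hD f Diff1_inv)+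
  moreover have "\<forall>x. ?p x > 0 \<and> ?m x > 0" using h by (auto simp: whitney_nbhd_def)
  moreover have "whitney_nbhd h ?p ?m \<subseteq> whitney_nbhd f \<epsilon>p \<epsilon>m"
  proof
    fix k assume k: "k \<in> whitney_nbhd h ?p ?m"
    then have kD: "k \<in> Diff1" by (simp add: whitney_nbhd_def)
    have "C1_gap k f x < \<epsilon>p x" "C1_gap (inv k) (inv f) x < \<epsilon>m x" for x
      using k tri[OF kD hD f, of x] tri[OF Diff1_inv[OF kD] Diff1_inv[OF hD] Diff1_inv[OF f], of x]
      unfolding whitney_nbhd_def mem_Collect_eq by (metis add.commute less_diff_eq order_le_less_trans add_less_cancel_right)+
    then show "k \<in> whitney_nbhd f \<epsilon>p \<epsilon>m" using kD by (simp add: whitney_nbhd_def)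
  qed
  ultimately show "\<exists>\<epsilon>p' \<epsilon>m'. continuous_on UNIV \<epsilon>p' \<and> continuous_on UNIV \<epsilon>m' \<and>
        (\<forall>x. \<epsilon>p' x > 0 \<and> \<epsilon>m' x > 0) \<and> whitney_nbhd h \<epsilon>p' \<epsilon>m' \<subseteq> whitney_nbhd f \<epsilon>p \<epsilon>m"
    by blast
qed

lemma self_in_whitney_nbhd:
  assumes "f \<in> Diff1" "\<And>x. \<epsilon>p x > 0" "\<And>x. \<epsilon>m x > 0"
  shows "f \<in> whitney_nbhd f \<epsilon>p \<epsilon>m"
  using assms by (simp add: whitney_nbhd_def C1_gap_eq Diff1_inv)

text \<open>The distance from the graph to the complement of \<open>W\<close> is such a radius. An
  empty complement is treated apart, because \<open>infdist\<close> to the empty set is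
  \<open>0\<close>.\<close>

lemma continuous_radius_of_open:
  fixes \<phi> :: "'a::metric_space \<Rightarrow> 'b::metric_space"
  assumes W: "open W" and \<phi>: "continuous_on UNIV \<phi>" and graph: "\<And>x. (x, \<phi> x) \<in> W"
  obtains \<epsilon> where "continuous_on UNIV \<epsilon>" "\<And>x. \<epsilon> x > (0::real)" "\<And>x y. dist y (\<phi> x) < \<epsilon> x \<Longrightarrow> (x, y) \<in> W"
proof (cases "- W = {}")
  case True
  then have "(x, y) \<in> W" for x y by blast
  then show ?thesis using that[of "\<lambda>_. 1"] by simp
next
  case False
  show ?thesis
  proof (rule that[of "\<lambda>x. infdist (x, \<phi> x) (- W)"])
    show "continuous_on UNIV (\<lambda>x. infdist (x, \<phi> x) (- W))"
      by (intro continuous_on_infdist continuous_on_Pair continuous_on_id \<phi>)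
    show "infdist (x, \<phi> x) (- W) > 0" for x
      using in_closed_iff_infdist_zero[of "- W" "(x, \<phi> x)"] W graph[of x] False infdist_nonneg[of "(x, \<phi> x)" "- W"]
      by (auto simp: closed_def less_le)
    show "(x, y) \<in> W" if "dist y (\<phi> x) < infdist (x, \<phi> x) (- W)" for x y
    proof (rule ccontr)
      assume "(x, y) \<notin> W"
      then have "infdist (x, \<phi> x) (- W) \<le> dist (x, \<phi> x) (x, y)" by (intro infdist_le) simp
      then show False using that by (simp add: dist_Pair_Pair dist_commute)
    qed
  qed
qed

text \<open>The defining inequality of a Lyapunov form, restricted to unit vectors and made strict, is an
  open condition on the triple \<open>(x, h x, Dh\<^sub>x)\<close>.\<close>

lemma lyapunov_form_stable:
  fixes f :: "'a::euclidean_space \<Rightarrow> 'a"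
  assumes f: "f \<in> Diff1" and g: "continuous_metric g" and c: "0 < c"
    and J_cont: "continuous_on UNIV (\<lambda>z. J (fst z) (snd z))"
    and J_hom: "\<And>x v r. J x (r *\<^sub>R v) = r\<^sup>2 * J x v"
    and J_mono: "\<And>x v. 2 * c * (g x v v + g (f x) (frechet_derivative f (at x) v) (frechet_derivative f (at x) v))
      \<le> J (f x) (frechet_derivative f (at x) v) - J x v"
  obtains \<epsilon> where "continuous_on UNIV \<epsilon>" "\<And>x. \<epsilon> x > 0"
    "\<forall>h\<in>Diff1. (\<forall>x. C1_gap h f x < \<epsilon> x) \<longrightarrow> (\<forall>x v.
      c * (g x v v + g (h x) (frechet_derivative h (at x) v) (frechet_derivative h (at x) v))
      \<le> J (h x) (frechet_derivative h (at x) v) - J x v)"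
proof -
  \<comment> \<open>The triple stands for an arbitrary candidate \<open>(x, h x, Dh)\<close>. As
    \<open>f\<close> satisfies the inequality with \<open>2 * c\<close>, its own triple leaves a
    strict surplus of \<open>c\<close> times the sum of squared lengths.\<close>
  define F where "F = (\<lambda>(x, y, B) v. J y (blinfun_apply B v) - J x v -
    c * (g x v v + g y (blinfun_apply B v) (blinfun_apply B v)))"
  define W where "W = {z :: 'a \<times> 'a \<times> ('a \<Rightarrow>\<^sub>L 'a). \<forall>v\<in>sphere 0 1. (z, v) \<in> {w. F (fst w) (snd w) > 0}}"
  have bil: "bilinear (g x)" for x using g by (simp add: continuous_metric_def)
  have "open W"
    unfolding W_def
  proof (rule open_compact_Ball[OF compact_sphere])
    let ?x = "\<lambda>w :: ('a \<times> 'a \<times> ('a \<Rightarrow>\<^sub>L 'a)) \<times> 'a. fst (fst w)"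
    let ?y = "\<lambda>w :: ('a \<times> 'a \<times> ('a \<Rightarrow>\<^sub>L 'a)) \<times> 'a. fst (snd (fst w))"
    let ?v = "\<lambda>w :: ('a \<times> 'a \<times> ('a \<Rightarrow>\<^sub>L 'a)) \<times> 'a. snd w"
    let ?Bv = "\<lambda>w :: ('a \<times> 'a \<times> ('a \<Rightarrow>\<^sub>L 'a)) \<times> 'a. blinfun_apply (snd (snd (fst w))) (snd w)"
    have cont: "continuous_on UNIV ?x" "continuous_on UNIV ?y" "continuous_on UNIV ?v" "continuous_on UNIV ?Bv"
      by (intro continuous_intros)+
    have J: "continuous_on UNIV (\<lambda>w. J (a w) (b w))" if "continuous_on UNIV a" "continuous_on UNIV b"
      for a b :: "('a \<times> 'a \<times> ('a \<Rightarrow>\<^sub>L 'a)) \<times> 'a \<Rightarrow> 'a"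
      using continuous_on_compose2[OF J_cont continuous_on_Pair[OF that]] by simp
    have "continuous_on UNIV (\<lambda>w. J (?y w) (?Bv w) - J (?x w) (?v w) -
        c * (g (?x w) (?v w) (?v w) + g (?y w) (?Bv w) (?Bv w)))"
      by (intro continuous_on_diff continuous_on_mult continuous_on_add continuous_on_const
          J cont continuous_on_metric[OF g cont(1) cont(3) cont(3)]
          continuous_on_metric[OF g cont(2) cont(4) cont(4)])
    then have "open {w. 0 < J (?y w) (?Bv w) - J (?x w) (?v w) -
        c * (g (?x w) (?v w) (?v w) + g (?y w) (?Bv w) (?Bv w))}"
      by (intro open_Collect_less continuous_on_const)
    then show "open {w. F (fst w) (snd w) > 0}" by (simp add: F_def case_prod_unfold)
  qed
  moreover have "continuous_on UNIV (\<lambda>x. (f x, blinfun_derivative f x))"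
    by (intro continuous_on_Pair Diff1_continuous_on continuous_blinfun_derivative f)
  moreover have "(x, f x, blinfun_derivative f x) \<in> W" for x
  proof -
    have "F (x, f x, blinfun_derivative f x) v > 0" if "norm v = 1" for v
    proof -
      let ?s = "g x v v + g (f x) (frechet_derivative f (at x) v) (frechet_derivative f (at x) v)"
      have "v \<noteq> 0" using that by auto
      then have "g x v v > 0" using g by (simp add: continuous_metric_def)
      then have "?s > 0" using continuous_metric_nonneg[OF g] by (intro add_pos_nonneg)
      then have "c * ?s > 0" using c by simp
      then show ?thesis using J_mono[of x v] by (simp add: F_def blinfun_derivative_apply f)
    qed
    then show ?thesis by (simp add: W_def)
  qed
  ultimately obtain \<epsilon> where \<epsilon>: "continuous_on UNIV \<epsilon>" "\<And>x. \<epsilon> x > (0::real)"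
    "\<And>x y. dist y (f x, blinfun_derivative f x) < \<epsilon> x \<Longrightarrow> (x, y) \<in> W"
    by (rule continuous_radius_of_open) (rule that; assumption)
  have "c * (g x v v + g (h x) (frechet_derivative h (at x) v) (frechet_derivative h (at x) v))
      \<le> J (h x) (frechet_derivative h (at x) v) - J x v"
    if h: "h \<in> Diff1" and gap: "\<And>x. C1_gap h f x < \<epsilon> x" for h x v
  proof (cases "v = 0")
    case True
    have "J y 0 = 0" for y using J_hom[of y 0 0] by simp
    then show ?thesis
      using True by (simp add: linear_0[OF Diff1_linear[OF h]] bilinear_lzero[OF bil])
  next
    case False
    have "dist (h x, blinfun_derivative h x) (f x, blinfun_derivative f x)
        \<le> dist (h x) (f x) + dist (blinfun_derivative h x) (blinfun_derivative f x)"
      by (simp only: dist_Pair_Pair sqrt_sum_squares_le_sum zero_le_dist)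
    also have "\<dots> < \<epsilon> x" using gap[of x] by (simp add: C1_gap_eq h f)
    finally have W: "(x, h x, blinfun_derivative h x) \<in> W" by (rule \<epsilon>(3))
    \<comment> \<open>Both sides of the inequality are quadratically homogeneous, so the unit vector
      decides.\<close>
    define w where "w = (1 / norm v) *\<^sub>R v"
    have v: "v = norm v *\<^sub>R w" and "norm w = 1" using False by (simp_all add: w_def)
    have "F (x, h x, blinfun_derivative h x) w > 0" using W \<open>norm w = 1\<close> by (simp add: W_def)
    then have "(norm v)\<^sup>2 * F (x, h x, blinfun_derivative h x) w \<ge> 0" by simp
    moreover have "(norm v)\<^sup>2 * F (x, h x, blinfun_derivative h x) w =
        J (h x) (frechet_derivative h (at x) (norm v *\<^sub>R w)) - J x (norm v *\<^sub>R w) -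
        c * (g x (norm v *\<^sub>R w) (norm v *\<^sub>R w) + g (h x) (frechet_derivative h (at x) (norm v *\<^sub>R w))
          (frechet_derivative h (at x) (norm v *\<^sub>R w)))"
      by (simp add: F_def blinfun_derivative_apply h linear_cmul[OF Diff1_linear[OF h]] J_hom
          bilinear_scaleR_diag[OF bil] algebra_simps)
    ultimately show ?thesis using v by simp
  qed
  then show ?thesis by (intro that[OF \<epsilon>(1,2)]) blast
qed

text \<open>Membership of \<open>h\<close> in \<open>Diff1\<close> is part of the conclusion, for
  use in the openness of the Anosov set. The constants depend only on the form and the metric, both
  fixed before \<open>h\<close> is chosen.\<close>

lemma anosov_stable:
  fixes f :: "'a::euclidean_space \<Rightarrow> 'a"
  assumes f: "f \<in> Diff1" and g: "complete_riemannian_metric g" and A: "anosov_with g f Es Eu C \<mu>"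
    and k: "\<And>x. dim (Es x) = k"
  shows "\<exists>g' \<U> C' \<mu>'. complete_riemannian_metric g' \<and>
    openin whitney_topology \<U> \<and> f \<in> \<U> \<and>
    (\<forall>h\<in>\<U>. h \<in> Diff1 \<and> (\<exists>Es' Eu'. anosov_with g' h Es' Eu' C' \<mu>' \<and>
       (\<forall>x. dim (Es' x) = k \<and> dim (Eu' x) = DIM('a) - k)))"
proof -
  have gc: "continuous_metric g"
    using g by (simp add: complete_riemannian_metric_def riemannian_imp_continuous_metric)
  obtain G J c K where G: "continuous_metric G" and gG: "\<And>x v. g x v v \<le> 2 * G x v v" and c: "0 < c"
    and Jc: "continuous_on UNIV (\<lambda>z. J (fst z) (snd z))" and Jb: "\<And>x v. \<bar>J x v\<bar> \<le> K * G x v v"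
    and Jh: "\<And>x v r. J x (r *\<^sub>R v) = r\<^sup>2 * J x v"
    and Jm: "\<And>x v. c * (G x v v + G (f x) (frechet_derivative f (at x) v) (frechet_derivative f (at x) v))
      \<le> J (f x) (frechet_derivative f (at x) v) - J x v"
    and Js: "\<And>x v. v \<in> Es x \<Longrightarrow> J x v \<le> 0" and Ju: "\<And>x v. v \<in> Eu x \<Longrightarrow> J x v \<ge> 0"
    by (rule anosov_lyapunov_form[OF f gc A]) (rule that; assumption)
  obtain g' L where g': "riemannian_metric g'" and L: "L > 0" and g'G: "\<And>x v. g' x v v \<le> L * G x v v"
    and Gg': "\<And>x v. G x v v \<le> L * g' x v v"
    by (rule smooth_comparable_metric[OF G]) (rule that; assumption)
  have g'c: "continuous_metric g'" by (rule riemannian_imp_continuous_metric[OF g'])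
  have "g x v v \<le> 2 * L * g' x v v" for x v using gG[of x v] Gg'[of x v] by simp
  then have complete: "complete_riemannian_metric g'"
    using complete_metric_mono[OF g g', of "2 * L"] L by simp
  \<comment> \<open>The factor \<open>L\<close> pays for replacing \<open>G\<close> by
    \<open>g'\<close>, the factor \<open>2\<close> is the slack consumed by the
    perturbation.\<close>
  define c' where "c' = c / (2 * L)"
  \<comment> \<open>The first entry bounds the form by \<open>g'\<close>; the second guarantees
    \<open>c' < K'\<close>.\<close>
  define K' where "K' = max (\<bar>K\<bar> * L) (c' + 1)"
  have c': "0 < c'" "c' < K'" using c L by (auto simp: c'_def K'_def)
  have Jb': "\<bar>J x v\<bar> \<le> K' * g' x v v" for x v
  proof -
    have "\<bar>J x v\<bar> \<le> \<bar>K\<bar> * G x v v"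
      using Jb[of x v] mult_right_mono[OF abs_ge_self[of K] continuous_metric_nonneg[OF G, of x v]] by linarith
    also have "\<dots> \<le> \<bar>K\<bar> * (L * g' x v v)" by (intro mult_left_mono Gg') simp
    also have "\<dots> \<le> K' * g' x v v"
      unfolding mult.assoc[symmetric] K'_def
      by (intro mult_right_mono continuous_metric_nonneg[OF g'c]) simp
    finally show ?thesis .
  qed
  have Jm': "2 * c' * (g' x v v + g' (f x) (frechet_derivative f (at x) v) (frechet_derivative f (at x) v))
      \<le> J (f x) (frechet_derivative f (at x) v) - J x v" for x v
  proof -
    let ?w = "frechet_derivative f (at x) v"
    have "2 * c' * (g' x v v + g' (f x) ?w ?w) \<le> 2 * c' * (L * G x v v + L * G (f x) ?w ?w)"
      using c' by (intro mult_left_mono add_mono g'G) auto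
    also have "\<dots> = c * (G x v v + G (f x) ?w ?w)" using L by (simp add: c'_def field_simps)
    also have "\<dots> \<le> J (f x) ?w - J x v" by (rule Jm)
    finally show ?thesis .
  qed
  obtain \<epsilon> where \<epsilon>: "continuous_on UNIV \<epsilon>" "\<And>x. \<epsilon> x > 0"
    and \<epsilon>J: "\<forall>h\<in>Diff1. (\<forall>x. C1_gap h f x < \<epsilon> x) \<longrightarrow> (\<forall>x v.
      c' * (g' x v v + g' (h x) (frechet_derivative h (at x) v) (frechet_derivative h (at x) v))
      \<le> J (h x) (frechet_derivative h (at x) v) - J x v)"
    by (rule lyapunov_form_stable[where J = J, OF f g'c c'(1) Jc Jh Jm']) (rule that; assumption)
  interpret splitting Es Eu
    using A by (auto simp: anosov_with_def intro: continuous_splitting_imp_splitting)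
  have dimu: "dim (Eu x) = DIM('a) - k" for x using dim_add[of x] k[of x] by simp
  have kn: "k \<le> DIM('a)" using dim_add[of 0] k[of 0] by simp
  \<comment> \<open>The backward size is the constant \<open>1\<close>: the increase of
    \<open>J\<close> under \<open>h\<close> at \<open>x\<close> already is the increase of
    \<open>- J\<close> under \<open>inv h\<close> at \<open>h x\<close>.\<close>
  let ?U = "whitney_nbhd f \<epsilon> (\<lambda>_. 1)"
  have "\<exists>Es' Eu'. anosov_with g' h Es' Eu' (sqrt (K' / c')) (sqrt (1 - c' / K')) \<and>
       (\<forall>x. dim (Es' x) = k \<and> dim (Eu' x) = DIM('a) - k)" if "h \<in> ?U" for h
  proof -
    have h: "h \<in> Diff1" and gap: "\<forall>x. C1_gap h f x < \<epsilon> x" using that by (auto simp: whitney_nbhd_def)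
    interpret lyapunov_form h g' J c' K'
      using h g'c Jc Jb' c' \<epsilon>J gap by unfold_locales blast+
    obtain Es' Eu' where "anosov_with g' h Es' Eu' (sqrt (K' / c')) (sqrt (1 - c' / K'))"
      "\<And>x. dim (Es' x) = k" "\<And>x. dim (Eu' x) = DIM('a) - k"
      by (rule anosov_with_lyapunov_form[where S = Es and U = Eu, OF subspace_E k Js subspace_F dimu Ju kn])
        (assumption, assumption, (rule that; assumption))
    then show ?thesis by blast
  qed
  moreover have "openin whitney_topology ?U"
    unfolding openin_whitney_topology by (intro whitney_open_nbhd f \<epsilon>(1) continuous_on_const)
  moreover have "f \<in> ?U" using f \<epsilon>(2) by (intro self_in_whitney_nbhd) auto
  moreover have "?U \<subseteq> Diff1" by (auto simp: whitney_nbhd_def)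
  ultimately show ?thesis using complete by blast
qed

theorem theorem1p4:
  shows "(\<forall>(f :: real^'n \<Rightarrow> real^'n) g Es Eu C \<mu> k.
            f \<in> Diff1 \<and> complete_riemannian_metric g \<and> anosov_with g f Es Eu C \<mu> \<and>
            (\<forall>x. dim (Es x) = k) \<longrightarrow>
            (\<exists>g' \<U> C' \<mu>'. complete_riemannian_metric g' \<and>
               openin whitney_topology \<U> \<and> f \<in> \<U> \<and>
               (\<forall>h\<in>\<U>. \<exists>Es' Eu'. anosov_with g' h Es' Eu' C' \<mu>' \<and>
                  (\<forall>x. dim (Es' x) = k \<and> dim (Eu' x) = CARD('n) - k))))
         \<and> openin whitney_topology
             {f :: real^'n \<Rightarrow> real^'n. f \<in> Diff1 \<and> admits_complete_anosov_metric f}"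
proof (intro conjI allI impI)
  fix f :: "real^'n \<Rightarrow> real^'n" and g Es Eu C \<mu> k
  assume "f \<in> Diff1 \<and> complete_riemannian_metric g \<and> anosov_with g f Es Eu C \<mu> \<and> (\<forall>x. dim (Es x) = k)"
  then have "f \<in> Diff1" "complete_riemannian_metric g" "anosov_with g f Es Eu C \<mu>" "\<And>x. dim (Es x) = k"
    by auto
  from anosov_stable[OF this]
  show "\<exists>g' \<U> C' \<mu>'. complete_riemannian_metric g' \<and>
               openin whitney_topology \<U> \<and> f \<in> \<U> \<and>
               (\<forall>h\<in>\<U>. \<exists>Es' Eu'. anosov_with g' h Es' Eu' C' \<mu>' \<and>
                  (\<forall>x. dim (Es' x) = k \<and> dim (Eu' x) = CARD('n) - k))"
    unfolding DIM_cart DIM_real mult_1_right by meson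
next
  let ?S = "{f :: real^'n \<Rightarrow> real^'n. f \<in> Diff1 \<and> admits_complete_anosov_metric f}"
  show "openin whitney_topology ?S"
  proof (subst openin_subopen, intro ballI)
    fix f assume "f \<in> ?S"
    then obtain g Es Eu C \<mu> where f: "f \<in> Diff1" and g: "complete_riemannian_metric g"
      and A: "anosov_with g f Es Eu C \<mu>"
      by (auto simp: admits_complete_anosov_metric_def)
    \<comment> \<open>Membership in the set prescribes no dimension; connectedness of the space
      supplies the constant \<open>k\<close> that \<open>anosov_stable\<close> requires.\<close>
    have "continuous_subbundle Es" using A by (simp add: anosov_with_def continuous_splitting_def)
    then obtain k where k: "\<And>x. dim (Es x) = k" using continuous_subbundle_dim_const by metis
    from anosov_stable[OF f g A k]
    obtain g' \<U> C' \<mu>' where g': "complete_riemannian_metric g'"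
      and \<U>: "openin whitney_topology \<U>" "f \<in> \<U>"
      and h: "\<forall>h\<in>\<U>. h \<in> Diff1 \<and> (\<exists>Es' Eu'. anosov_with g' h Es' Eu' C' \<mu>' \<and>
        (\<forall>x. dim (Es' x) = k \<and> dim (Eu' x) = DIM(real^'n) - k))"
      by (elim exE conjE)
    have "\<U> \<subseteq> ?S"
    proof
      fix h assume "h \<in> \<U>"
      then obtain Es' Eu' where "h \<in> Diff1" "anosov_with g' h Es' Eu' C' \<mu>'" using h by blast
      then show "h \<in> ?S" using g' unfolding admits_complete_anosov_metric_def by blast
    qed
    then show "\<exists>T. openin whitney_topology T \<and> f \<in> T \<and> T \<subseteq> ?S" using \<U> by blast
  qed
qed

end
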